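(* Let $d\ge2$ and consider the $S=\frac12$ XX model on the infinite lattice $\mathbb Z^d$ with formal Hamiltonian $\hat H=\sum_{u\in\mathbb Z^d}\hat h_u$, $\hat h_u=-\sum_{\alpha=1}^d\{\hat X_u\hat X_{u+\boldsymbol e_\alpha}+\hat Y_u\hat Y_{u+\boldsymbol e_\alpha}\}$, where $\boldsymbol e_\alpha$ is the unit vector in the $\alpha$-direction. Let $F:\mathbb N\to(0,\infty)$ be a decreasing function satisfying $$\lim_{k\uparrow\infty}(4d^2)^k\,(k!)^{d+3}\,F(k)=0.$$ Then there exist no quasi-local conserved quantities with decay function $F$.
   Context: A product of Pauli matrices on $\mathbb Z^d$ is $\boldsymbol{\hat A}=\bigotimes_{u\in S}\hat A_u$ with $S=\operatorname{Supp}\boldsymbol{\hat A}$ a nonempty finite subset of $\mathbb Z^d$ and $\hat A_u\in\{\hat X_u,\hat Y_u,\hat Z_u\}$ a Pauli matrix at site $u$ (identity elsewhere). $\mathcal P_{\mathbb Z^d}$ is the set of all products. For finite nonempty $S\subset\mathbb Z^d$, $\operatorname{Wid}_\alpha S$ is the minimum $k$ such that for some $a\in\mathbb Z$ one has $0\le (u)_\alpha-a\le k-1$ for all $u\in S$ ($(u)_\alpha$ the $\alpha$-th coordinate); $\operatorname{Wid}\boldsymbol{\hat A}=\max_{\alpha}\operatorname{Wid}_\alpha\operatorname{Supp}\boldsymbol{\hat A}$. For a product $\boldsymbol{\hat A}$ the commutator with the formal Hamiltonian is defined by the finite sum $[\hat H,\boldsymbol{\hat A}]=\sum_{u:\ \operatorname{Supp}\hat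 h_u\cap\operatorname{Supp}\boldsymbol{\hat A}\neq\emptyset}[\hat h_u,\boldsymbol{\hat A}]$, and is uniquely expanded as $[\hat H,\boldsymbol{\hat A}]=\sum_{\boldsymbol{\hat B}\in\mathcal P_{\mathbb Z^d}}\lambda_{\boldsymbol{\hat A},\boldsymbol{\hat B}}\boldsymbol{\hat B}$; for given $\boldsymbol{\hat B}$ only finitely many $\boldsymbol{\hat A}$ have $\lambda_{\boldsymbol{\hat A},\boldsymbol{\hat B}}\neq0$. A candidate $\hat Q$ is a formal sum $\hat Q=\sum_{\boldsymbol{\hat A}\in\mathcal P_{\mathbb Z^d}}q_{\boldsymbol{\hat A}}\boldsymbol{\hat A}$ with $q_{\boldsymbol{\hat A}}\in\mathbb C$ (i.e. a family of coefficients), and one sets $c_{\boldsymbol{\hat B}}=\sum_{\boldsymbol{\hat A}}\lambda_{\boldsymbol{\hat A},\boldsymbol{\hat B}}\,q_{\boldsymbol{\hat A}}$ (a finite sum). $\hat Q$ is a local conserved quantity if $c_{\boldsymbol{\hat B}}=0$ for all $\boldsymbol{\hat B}$ and there is a finite $k_{\max}$ with $q_{\boldsymbol{\hat A}}=0$ whenever $\operatorname{Wid}\boldsymbol{\hat A}>k_{\max}$. A quasi-local conserved quantity with decay function $F$ is a nonzero (not all coefficients zero) $\hat Q$ such that $|q_{\boldsymbol{\hat A}}|\le F(\operatorname{Wid}\boldsymbol{\hat A})$ for all $\boldsymbol{\hat A}\in\mathcal P_{\mathbb Z^d}$, $c_{\boldsymbol{\hat B}}=0$ for all $\boldsymbol{\hat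 B}\in\mathcal P_{\mathbb Z^d}$, and $\hat Q$ is not a local conserved quantity. *)

theory Defs
  imports "HOL-Analysis.Analysis"
begin

type_synonym 'd site = "int ^ 'd"

text \<open>A spin configuration assigns to every site one of the two basis states of \<open>\<complex>\<^sup>2\<close>, namely \<open>1\<close> (up)
  or \<open>2\<close> (down). On the infinite lattice, local operators act linearly on arbitrary complex functions
  of the configuration; this representation of the algebra of local operators is faithful, and the
  operator product is composition of maps.\<close>

type_synonym 'd config = "'d site \<Rightarrow> 2"
type_synonym 'd lattice_op = "('d config \<Rightarrow> complex) \<Rightarrow> ('d config \<Rightarrow> complex)"

datatype pauli = PX | PY | PZ

fun pauli_matrix :: "pauli \<Rightarrow> complex ^ 2 ^ 2" where
  "pauli_matrix PX = vector [vector [0, 1], vector [1, 0]]"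
| "pauli_matrix PY = vector [vector [0, - \<i>], vector [\<i>, 0]]"
| "pauli_matrix PZ = vector [vector [1, 0], vector [0, - 1]]"

text \<open>A product of Pauli matrices is encoded as a partial map from sites to Pauli matrices; its
  support is the domain of the map.\<close>

type_synonym 'd pauli_map = "'d site \<rightharpoonup> pauli"

definition pauli_products :: "('d::finite) pauli_map set" where
  "pauli_products = {A. finite (dom A) \<and> dom A \<noteq> {}}"

text \<open>The operator \<open>\<Otimes>\<^sub>u A\<^sub>u\<close>. The configurations \<open>\<tau>\<close> summed over are those agreeing with \<open>\<sigma>\<close> outside the
  support; there are finitely many of them if the support is finite.\<close>

definition pauli_op :: "('d::finite) pauli_map \<Rightarrow> 'd lattice_op" where
  "pauli_op A \<psi> \<sigma> =
     (\<Sum>\<tau> | \<forall>u. u \<notin> dom A \<longrightarrow> \<tau> u = \<sigma> u.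
        (\<Prod>u\<in>dom A. pauli_matrix (the (A u)) $ \<sigma> u $ \<tau> u) * \<psi> \<tau>)"

definition wid_dir :: "'d::finite \<Rightarrow> 'd site set \<Rightarrow> nat" where
  "wid_dir \<alpha> S = (LEAST k. \<exists>a::int. \<forall>u\<in>S. 0 \<le> u $ \<alpha> - a \<and> u $ \<alpha> - a \<le> int k - 1)"

definition wid :: "('d::finite) pauli_map \<Rightarrow> nat" where
  "wid A = Max (range (\<lambda>\<alpha>. wid_dir \<alpha> (dom A)))"

definition unit_vec :: "'d::finite \<Rightarrow> 'd site" where
  "unit_vec \<alpha> = axis \<alpha> 1"

definition xx_local :: "('d::finite) site \<Rightarrow> 'd lattice_op" where
  "xx_local u \<psi> \<sigma> =
     - (\<Sum>\<alpha>\<in>UNIV. pauli_op [u \<mapsto> PX, u + unit_vec \<alpha> \<mapsto> PX] \<psi> \<sigma>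
                  + pauli_op [u \<mapsto> PY, u + unit_vec \<alpha> \<mapsto> PY] \<psi> \<sigma>)"

definition xx_local_supp :: "('d::finite) site \<Rightarrow> 'd site set" where
  "xx_local_supp u = insert u (range (\<lambda>\<alpha>. u + unit_vec \<alpha>))"

definition commutator :: "('d::finite) lattice_op \<Rightarrow> 'd lattice_op \<Rightarrow> 'd lattice_op" where
  "commutator T U \<psi> \<sigma> = T (U \<psi>) \<sigma> - U (T \<psi>) \<sigma>"

definition comm_H :: "('d::finite) pauli_map \<Rightarrow> 'd lattice_op" where
  "comm_H A \<psi> \<sigma> =
     (\<Sum>u | xx_local_supp u \<inter> dom A \<noteq> {}. commutator (xx_local u) (pauli_op A) \<psi> \<sigma>)"

definition pauli_expansion :: "('d::finite) lattice_op \<Rightarrow> ('d pauli_map \<Rightarrow> complex) \<Rightarrow> bool" where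
  "pauli_expansion T c \<longleftrightarrow>
     finite {B. c B \<noteq> 0} \<and> {B. c B \<noteq> 0} \<subseteq> pauli_products \<and>
     T = (\<lambda>\<psi> \<sigma>. \<Sum>B | c B \<noteq> 0. c B * pauli_op B \<psi> \<sigma>)"

text \<open>The coefficients \<open>\<lambda>\<^bsub>A,B\<^esub>\<close> in the unique expansion of \<open>[H, A]\<close>; existence and uniqueness of the
  expansion are proved in \<open>comm_H_expansion\<close> below.\<close>

definition comm_coeff :: "('d::finite) pauli_map \<Rightarrow> 'd pauli_map \<Rightarrow> complex" where
  "comm_coeff A = (THE c. pauli_expansion (comm_H A) c)"

text \<open>A candidate is a family of coefficients; only its values on \<^const>\<open>pauli_products\<close> are relevant.\<close>

type_synonym 'd candidate = "'d pauli_map \<Rightarrow> complex"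

text \<open>The sum is finite by \<open>finite_comm_coeff_nonzero\<close> below.\<close>

definition conserved_coeff :: "('d::finite) candidate \<Rightarrow> 'd pauli_map \<Rightarrow> complex" where
  "conserved_coeff q B =
     (\<Sum>A | A \<in> pauli_products \<and> comm_coeff A B \<noteq> 0. comm_coeff A B * q A)"

definition local_conserved_quantity :: "('d::finite) candidate \<Rightarrow> bool" where
  "local_conserved_quantity q \<longleftrightarrow>
     (\<forall>B\<in>pauli_products. conserved_coeff q B = 0) \<and>
     (\<exists>kmax. \<forall>A\<in>pauli_products. wid A > kmax \<longrightarrow> q A = 0)"

definition quasi_local_conserved_quantity :: "(nat \<Rightarrow> real) \<Rightarrow> ('d::finite) candidate \<Rightarrow> bool" where
  "quasi_local_conserved_quantity F q \<longleftrightarrow>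
     (\<exists>A\<in>pauli_products. q A \<noteq> 0) \<and>
     (\<forall>A\<in>pauli_products. norm (q A) \<le> F (wid A)) \<and>
     (\<forall>B\<in>pauli_products. conserved_coeff q B = 0) \<and>
     \<not> local_conserved_quantity q"


subsection \<open>Well-definedness of the expansion of the commutator\<close>

text \<open>A Pauli matrix maps basis states to multiples of basis states:
  its \<open>s\<close>-th row has the single nonzero entry \<open>pauli_phase p s\<close>, in column \<open>pauli_flip p s\<close>.
  \<open>None\<close> stands for the identity.\<close>

fun pauli_phase :: "pauli option \<Rightarrow> 2 \<Rightarrow> complex" where
  "pauli_phase None s = 1"
| "pauli_phase (Some PX) s = 1"
| "pauli_phase (Some PY) s = (if s = 1 then - \<i> else \<i>)"
| "pauli_phase (Some PZ) s = (if s = 1 then 1 else - 1)"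

fun pauli_flip :: "pauli option \<Rightarrow> 2 \<Rightarrow> 2" where
  "pauli_flip None s = s"
| "pauli_flip (Some PZ) s = s"
| "pauli_flip (Some PX) s = (if s = 1 then 2 else 1)"
| "pauli_flip (Some PY) s = (if s = 1 then 2 else 1)"

text \<open>The product of two single-site matrices \<open>a\<close> and \<open>b\<close> is \<open>site_sign a b\<close> times \<open>site_mult a b\<close>.\<close>

fun site_mult :: "pauli option \<Rightarrow> pauli option \<Rightarrow> pauli option" where
  "site_mult None b = b"
| "site_mult (Some p) None = Some p"
| "site_mult (Some PX) (Some PX) = None"
| "site_mult (Some PX) (Some PY) = Some PZ"
| "site_mult (Some PX) (Some PZ) = Some PY"
| "site_mult (Some PY) (Some PX) = Some PZ"
| "site_mult (Some PY) (Some PY) = None"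
| "site_mult (Some PY) (Some PZ) = Some PX"
| "site_mult (Some PZ) (Some PX) = Some PY"
| "site_mult (Some PZ) (Some PY) = Some PX"
| "site_mult (Some PZ) (Some PZ) = None"

fun site_sign :: "pauli option \<Rightarrow> pauli option \<Rightarrow> complex" where
  "site_sign (Some PX) (Some PY) = \<i>"
| "site_sign (Some PY) (Some PX) = - \<i>"
| "site_sign (Some PY) (Some PZ) = \<i>"
| "site_sign (Some PZ) (Some PY) = - \<i>"
| "site_sign (Some PZ) (Some PX) = \<i>"
| "site_sign (Some PX) (Some PZ) = - \<i>"
| "site_sign a b = 1"

lemma pauli_option_cases [case_names None PX PY PZ]:
  obtains "a = None" | "a = Some PX" | "a = Some PY" | "a = Some PZ"
  by (metis not_None_eq pauli.exhaust)

lemma pauli_matrix_entry: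
  "pauli_matrix p $ s $ t = (if t = pauli_flip (Some p) s then pauli_phase (Some p) s else 0)"
proof -
  have *: "\<forall>s t. pauli_matrix p $ s $ t = (if t = pauli_flip (Some p) s then pauli_phase (Some p) s else 0)"
    by (cases p) (simp_all add: forall_2)
  show ?thesis using * by blast
qed

lemma site_phase_mult:
  "pauli_phase a s * pauli_phase b (pauli_flip a s) = site_sign a b * pauli_phase (site_mult a b) s"
  by (cases a rule: pauli_option_cases; cases b rule: pauli_option_cases) simp_all

lemma two_eq_two_cases: "(s::2) \<noteq> 1 \<Longrightarrow> s = 2"
  using exhaust_2[of s] by blast

lemma site_flip_mult: "pauli_flip b (pauli_flip a s) = pauli_flip (site_mult a b) s"
  by (cases a rule: pauli_option_cases; cases b rule: pauli_option_cases)
     (auto dest: two_eq_two_cases)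

lemma site_mult_commute: "site_mult a b = site_mult b a"
  by (cases a rule: pauli_option_cases; cases b rule: pauli_option_cases) simp_all

lemma site_mult_cancel: "site_mult a (site_mult a b) = b"
  by (cases a rule: pauli_option_cases; cases b rule: pauli_option_cases) simp_all

lemma site_mult_eq_None: "site_mult a b = None \<longleftrightarrow> a = b"
  by (cases a rule: pauli_option_cases; cases b rule: pauli_option_cases) simp_all

lemma site_sign_None [simp]: "site_sign None b = 1" "site_sign a None = 1"
  by (cases a rule: pauli_option_cases; simp; cases b rule: pauli_option_cases; simp)+

lemma site_sign_self [simp]: "site_sign a a = 1"
  by (cases a rule: pauli_option_cases) simp_all

lemma site_orthogonal:
  "(\<Sum>s\<in>UNIV. cnj (pauli_phase a s) * pauli_phase b s * (if pauli_flip b s = pauli_flip a s then 1 else 0))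
     = (if a = b then 2 else 0)"
  by (cases a rule: pauli_option_cases; cases b rule: pauli_option_cases)
     (simp_all add: sum_2)

definition config_flip :: "('d::finite) pauli_map \<Rightarrow> 'd config \<Rightarrow> 'd config" where
  "config_flip A \<sigma> u = pauli_flip (A u) (\<sigma> u)"

definition config_phase :: "('d::finite) pauli_map \<Rightarrow> 'd config \<Rightarrow> complex" where
  "config_phase A \<sigma> = (\<Prod>u\<in>dom A. pauli_phase (A u) (\<sigma> u))"

definition map_mult :: "('d::finite) pauli_map \<Rightarrow> 'd pauli_map \<Rightarrow> 'd pauli_map" where
  "map_mult A B u = site_mult (A u) (B u)"

definition map_sign :: "('d::finite) pauli_map \<Rightarrow> 'd pauli_map \<Rightarrow> complex" where
  "map_sign A B = (\<Prod>u\<in>dom A \<inter> dom B. site_sign (A u) (B u))"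

lemma config_phase_superset:
  assumes "finite S" "dom A \<subseteq> S"
  shows "config_phase A \<sigma> = (\<Prod>u\<in>S. pauli_phase (A u) (\<sigma> u))"
  unfolding config_phase_def using assms
proof (intro prod.mono_neutral_left ballI)
  fix u assume "u \<in> S - dom A"
  then have "A u = None" by auto
  then show "pauli_phase (A u) (\<sigma> u) = 1" by simp
qed auto

lemma map_sign_superset:
  assumes "finite S" "dom A \<inter> dom B \<subseteq> S"
  shows "map_sign A B = (\<Prod>u\<in>S. site_sign (A u) (B u))"
  unfolding map_sign_def using assms
proof (intro prod.mono_neutral_left ballI)
  fix u assume "u \<in> S - dom A \<inter> dom B"
  then have "A u = None \<or> B u = None" by auto
  then show "site_sign (A u) (B u) = 1" by auto
qed auto

lemma finite_local_configs:
  fixes \<sigma> :: "'d::finite config"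
  assumes "finite S"
  shows "finite {\<tau>. \<forall>u. u \<notin> S \<longrightarrow> \<tau> u = \<sigma> u}"
proof -
  have "{\<tau>. \<forall>u. u \<notin> S \<longrightarrow> \<tau> u = \<sigma> u} \<subseteq> (\<lambda>f u. if u \<in> S then f u else \<sigma> u) ` (PiE S (\<lambda>_. UNIV))"
  proof
    fix \<tau> assume *: "\<tau> \<in> {\<tau>. \<forall>u. u \<notin> S \<longrightarrow> \<tau> u = \<sigma> u}"
    have eq: "\<tau> = (\<lambda>u. if u \<in> S then restrict \<tau> S u else \<sigma> u)" using * by auto
    show "\<tau> \<in> (\<lambda>f u. if u \<in> S then f u else \<sigma> u) ` (PiE S (\<lambda>_. UNIV))"
      by (rule image_eqI[where x = "restrict \<tau> S"]) (use eq in simp_all)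
  qed
  moreover have "finite (PiE S (\<lambda>_. UNIV :: 2 set))" using assms by (intro finite_PiE) auto
  ultimately show ?thesis by (rule finite_subset[OF _ finite_imageI])
qed

lemma pauli_op_apply:
  assumes "finite (dom A)"
  shows "pauli_op A \<psi> \<sigma> = config_phase A \<sigma> * \<psi> (config_flip A \<sigma>)"
proof -
  let ?C = "{\<tau>. \<forall>u. u \<notin> dom A \<longrightarrow> \<tau> u = \<sigma> u}"
  let ?g = "\<lambda>\<tau>. (\<Prod>u\<in>dom A. pauli_matrix (the (A u)) $ \<sigma> u $ \<tau> u) * \<psi> \<tau>"
  have fin: "finite ?C" by (rule finite_local_configs[OF assms])
  have mem: "config_flip A \<sigma> \<in> ?C" by (auto simp: config_flip_def domIff)
  have zero: "?g \<tau> = 0" if "\<tau> \<in> ?C - {config_flip A \<sigma>}" for \<tau>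
  proof -
    from that have "\<tau> \<noteq> config_flip A \<sigma>" by simp
    then obtain u where u: "\<tau> u \<noteq> config_flip A \<sigma> u" by blast
    with that have d: "u \<in> dom A" by (auto simp: config_flip_def domIff)
    then have "pauli_matrix (the (A u)) $ \<sigma> u $ \<tau> u = 0"
      using u by (auto simp: pauli_matrix_entry config_flip_def)
    then have "(\<Prod>u\<in>dom A. pauli_matrix (the (A u)) $ \<sigma> u $ \<tau> u) = 0"
      using assms d by (meson prod_zero)
    then show ?thesis by simp
  qed
  have "pauli_op A \<psi> \<sigma> = sum ?g ?C" by (simp add: pauli_op_def)
  also have "\<dots> = sum ?g {config_flip A \<sigma>}"
    by (rule sum.mono_neutral_right) (use fin mem zero in auto)
  also have "\<dots> = (\<Prod>u\<in>dom A. pauli_phase (A u) (\<sigma> u)) * \<psi> (config_flip A \<sigma>)"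
    by (auto simp: pauli_matrix_entry config_flip_def intro!: prod.cong)
  finally show ?thesis by (simp add: config_phase_def)
qed

lemma dom_map_mult: "dom (map_mult A B) \<subseteq> dom A \<union> dom B"
  by (auto simp: map_mult_def domIff)

lemma map_mult_commute: "map_mult A B = map_mult B A"
  by (rule ext) (simp add: map_mult_def site_mult_commute)

lemma map_mult_cancel: "map_mult A (map_mult A B) = B"
  by (rule ext) (simp add: map_mult_def site_mult_cancel)

lemma pauli_op_mult:
  assumes "finite (dom A)" "finite (dom B)"
  shows "pauli_op A (pauli_op B \<psi>) \<sigma> = map_sign A B * pauli_op (map_mult A B) \<psi> \<sigma>"
proof -
  let ?S = "dom A \<union> dom B"
  have S: "finite ?S" using assms by simp
  have fin: "finite (dom (map_mult A B))" using dom_map_mult S by (rule finite_subset)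
  have flip: "config_flip B (config_flip A \<sigma>) = config_flip (map_mult A B) \<sigma>"
    by (rule ext) (simp add: config_flip_def map_mult_def site_flip_mult)
  have sign: "map_sign A B = (\<Prod>u\<in>?S. site_sign (A u) (B u))"
    by (rule map_sign_superset[OF S]) blast
  have "config_phase A \<sigma> * config_phase B (config_flip A \<sigma>)
      = (\<Prod>u\<in>?S. pauli_phase (A u) (\<sigma> u) * pauli_phase (B u) (pauli_flip (A u) (\<sigma> u)))"
    using S by (simp add: config_phase_superset[of ?S] config_flip_def prod.distrib)
  also have "\<dots> = (\<Prod>u\<in>?S. site_sign (A u) (B u)) * (\<Prod>u\<in>?S. pauli_phase (map_mult A B u) (\<sigma> u))"
    by (simp add: site_phase_mult map_mult_def prod.distrib)
  also have "\<dots> = map_sign A B * config_phase (map_mult A B) \<sigma>"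
    by (simp add: sign config_phase_superset[OF S dom_map_mult])
  finally show ?thesis
    by (simp add: pauli_op_apply assms fin flip mult.assoc[symmetric])
qed

text \<open>Linear independence of products of Pauli matrices, via orthogonality of the
  Hilbert-Schmidt pairing on a finite region containing all supports.\<close>

lemma pauli_independent:
  fixes c :: "('d::finite) pauli_map \<Rightarrow> complex"
  assumes fin: "finite I" and dom: "\<And>B. B \<in> I \<Longrightarrow> finite (dom B)"
    and zero: "\<And>\<psi> \<sigma>. (\<Sum>B\<in>I. c B * pauli_op B \<psi> \<sigma>) = 0" and C: "C \<in> I"
  shows "c C = 0"
proof -
  let ?S = "\<Union>B\<in>I. dom B"
  let ?E = "PiE ?S (\<lambda>_. UNIV :: 2 set)"
  let ?\<delta> = "\<lambda>\<sigma> \<tau>. if \<tau> = config_flip C \<sigma> then 1 else 0 :: complex"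
  let ?e = "\<lambda>B u s. cnj (pauli_phase (C u) s) * pauli_phase (B u) s *
              (if pauli_flip (B u) s = pauli_flip (C u) s then 1 else 0 :: complex)"
  have S: "finite ?S" using fin dom by blast
  have pair: "cnj (config_phase C \<sigma>) * pauli_op B (?\<delta> \<sigma>) \<sigma> = (\<Prod>u\<in>?S. ?e B u (\<sigma> u))"
    if "B \<in> I" for B \<sigma>
  proof -
    have sub: "dom B \<subseteq> ?S" "dom C \<subseteq> ?S" using that C by auto
    have "(if config_flip B \<sigma> = config_flip C \<sigma> then 1 else 0 :: complex)
        = (\<Prod>u\<in>?S. if pauli_flip (B u) (\<sigma> u) = pauli_flip (C u) (\<sigma> u) then 1 else 0)"
    proof (cases "config_flip B \<sigma> = config_flip C \<sigma>")
      case True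
      then show ?thesis by (auto simp: config_flip_def fun_eq_iff)
    next
      case False
      then obtain u where u: "pauli_flip (B u) (\<sigma> u) \<noteq> pauli_flip (C u) (\<sigma> u)"
        by (auto simp: config_flip_def fun_eq_iff)
      have "u \<in> ?S"
      proof (rule ccontr)
        assume "u \<notin> ?S"
        with sub have "u \<notin> dom B" "u \<notin> dom C" by blast+
        then have "B u = None" "C u = None" by (simp_all add: domIff)
        with u show False by simp
      qed
      then have "(\<Prod>u\<in>?S. if pauli_flip (B u) (\<sigma> u) = pauli_flip (C u) (\<sigma> u) then 1 else 0 :: complex) = 0"
        using u by (intro prod_zero[OF S] bexI[of _ u]) auto
      with False show ?thesis by simp
    qed
    then show ?thesis
      using sub that dom
      by (simp add: pauli_op_apply config_phase_superset[OF S] prod.distrib mult.assoc)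
  qed
  have orth: "(\<Sum>\<sigma>\<in>?E. \<Prod>u\<in>?S. ?e B u (\<sigma> u)) = (if B = C then 2 ^ card ?S else 0)"
    if "B \<in> I" for B
  proof -
    have "(\<Sum>\<sigma>\<in>?E. \<Prod>u\<in>?S. ?e B u (\<sigma> u)) = (\<Prod>u\<in>?S. \<Sum>s\<in>UNIV. ?e B u s)"
      using S by (subst prod_sum_PiE) auto
    also have "\<dots> = (\<Prod>u\<in>?S. if C u = B u then 2 else 0)"
      by (simp add: site_orthogonal)
    also have "\<dots> = (if B = C then 2 ^ card ?S else 0)"
    proof (cases "B = C")
      case False
      then obtain u where u: "B u \<noteq> C u" by blast
      then have "u \<in> dom B \<union> dom C" by (metis Un_iff domIff)
      then have "u \<in> ?S" using that C by blast
      with u have "(\<Prod>u\<in>?S. if C u = B u then 2 else 0 :: complex) = 0"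
        by (intro prod_zero[OF S] bexI[of _ u]) auto
      with False show ?thesis by simp
    qed simp
    finally show ?thesis .
  qed
  have "0 = (\<Sum>\<sigma>\<in>?E. cnj (config_phase C \<sigma>) * (\<Sum>B\<in>I. c B * pauli_op B (?\<delta> \<sigma>) \<sigma>))"
    by (simp add: zero)
  also have "\<dots> = (\<Sum>\<sigma>\<in>?E. \<Sum>B\<in>I. c B * (\<Prod>u\<in>?S. ?e B u (\<sigma> u)))"
    by (intro sum.cong refl) (simp add: sum_distrib_left pair[symmetric] mult.left_commute)
  also have "\<dots> = (\<Sum>B\<in>I. c B * (\<Sum>\<sigma>\<in>?E. \<Prod>u\<in>?S. ?e B u (\<sigma> u)))"
    by (subst sum.swap) (simp add: sum_distrib_left)
  also have "\<dots> = (\<Sum>B\<in>I. if B = C then c C * 2 ^ card ?S else 0)"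
    by (intro sum.cong refl) (simp add: orth)
  also have "\<dots> = c C * 2 ^ card ?S" using fin C by simp
  finally show ?thesis by simp
qed

lemma pauli_expansion_unique:
  assumes "pauli_expansion T c" "pauli_expansion T c'"
  shows "c = c'"
proof (rule ext)
  fix C
  let ?I = "{B. c B \<noteq> 0} \<union> {B. c' B \<noteq> 0}"
  have fin: "finite ?I" and dom: "\<And>B. B \<in> ?I \<Longrightarrow> finite (dom B)"
    using assms unfolding pauli_expansion_def pauli_products_def by auto
  have ext: "(\<Sum>B | e B \<noteq> 0. e B * pauli_op B \<psi> \<sigma>) = (\<Sum>B\<in>?I. e B * pauli_op B \<psi> \<sigma>)"
    if "e = c \<or> e = c'" for e :: "'a pauli_map \<Rightarrow> complex" and \<psi> \<sigma>
    by (rule sum.mono_neutral_left) (use fin that in auto)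
  have "(\<Sum>B | c B \<noteq> 0. c B * pauli_op B \<psi> \<sigma>) = (\<Sum>B | c' B \<noteq> 0. c' B * pauli_op B \<psi> \<sigma>)" for \<psi> \<sigma>
    using assms unfolding pauli_expansion_def by metis
  then have zero: "(\<Sum>B\<in>?I. (c B - c' B) * pauli_op B \<psi> \<sigma>) = 0" for \<psi> \<sigma>
    using ext[of c] ext[of c'] by (simp add: left_diff_distrib sum_subtractf)
  show "c C = c' C"
  proof (cases "C \<in> ?I")
    case True
    have "c C - c' C = 0" by (rule pauli_independent[OF fin dom zero True])
    then show ?thesis by simp
  qed simp
qed

lemma pauli_expansion_zero: "pauli_expansion (\<lambda>\<psi> \<sigma>. 0) (\<lambda>B. 0)"
  by (simp add: pauli_expansion_def)

lemma pauli_expansionI: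
  assumes "finite I" "I \<subseteq> pauli_products" "\<And>B. B \<notin> I \<Longrightarrow> c B = 0"
    "\<And>\<psi> \<sigma>. T \<psi> \<sigma> = (\<Sum>B\<in>I. c B * pauli_op B \<psi> \<sigma>)"
  shows "pauli_expansion T c"
proof -
  have sub: "{B. c B \<noteq> 0} \<subseteq> I" using assms(3) by blast
  have "(\<Sum>B\<in>I. c B * pauli_op B \<psi> \<sigma>) = (\<Sum>B | c B \<noteq> 0. c B * pauli_op B \<psi> \<sigma>)" for \<psi> \<sigma>
    by (rule sum.mono_neutral_right) (use assms(1) sub in auto)
  then show ?thesis
    unfolding pauli_expansion_def using sub assms finite_subset by (auto simp: fun_eq_iff)
qed

lemma pauli_expansion_add:
  assumes "pauli_expansion T c" "pauli_expansion T' c'"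
  shows "pauli_expansion (\<lambda>\<psi> \<sigma>. T \<psi> \<sigma> + T' \<psi> \<sigma>) (\<lambda>B. c B + c' B)"
proof (rule pauli_expansionI[where I = "{B. c B \<noteq> 0} \<union> {B. c' B \<noteq> 0}"])
  let ?I = "{B. c B \<noteq> 0} \<union> {B. c' B \<noteq> 0}"
  show fin: "finite ?I" and "?I \<subseteq> pauli_products"
    using assms unfolding pauli_expansion_def by auto
  fix \<psi> \<sigma>
  have "(\<Sum>B | c B \<noteq> 0. c B * pauli_op B \<psi> \<sigma>) = (\<Sum>B\<in>?I. c B * pauli_op B \<psi> \<sigma>)"
    and "(\<Sum>B | c' B \<noteq> 0. c' B * pauli_op B \<psi> \<sigma>) = (\<Sum>B\<in>?I. c' B * pauli_op B \<psi> \<sigma>)"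
    by (rule sum.mono_neutral_left; use fin in auto)+
  then show "T \<psi> \<sigma> + T' \<psi> \<sigma> = (\<Sum>B\<in>?I. (c B + c' B) * pauli_op B \<psi> \<sigma>)"
    using assms unfolding pauli_expansion_def by (simp add: distrib_right sum.distrib)
qed auto

lemma pauli_expansion_sum:
  assumes "finite J" "\<And>j. j \<in> J \<Longrightarrow> pauli_expansion (T j) (c j)"
  shows "pauli_expansion (\<lambda>\<psi> \<sigma>. \<Sum>j\<in>J. T j \<psi> \<sigma>) (\<lambda>B. \<Sum>j\<in>J. c j B)"
  using assms
proof (induction J rule: finite_induct)
  case empty
  then show ?case by (simp add: pauli_expansion_zero)
next
  case (insert j J)
  then show ?case using pauli_expansion_add[of "T j" "c j"] by simp
qed

definition bond :: "('d::finite) site \<Rightarrow> 'd \<Rightarrow> pauli \<Rightarrow> 'd pauli_map" where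
  "bond u \<alpha> p = [u \<mapsto> p, u + unit_vec \<alpha> \<mapsto> p]"

text \<open>The contribution of one bond \<open>D\<close> of the Hamiltonian, entering with coefficient \<open>-1\<close>,
  to \<open>\<lambda>\<^bsub>A,B\<^esub>\<close>.\<close>

definition bond_coeff :: "('d::finite) pauli_map \<Rightarrow> 'd pauli_map \<Rightarrow> 'd pauli_map \<Rightarrow> complex" where
  "bond_coeff D A B = (if B = map_mult D A then map_sign A D - map_sign D A else 0)"

lemma dom_bond: "dom (bond u \<alpha> p) = {u, u + unit_vec \<alpha>}"
  by (auto simp: bond_def)

lemma map_sign_Int_empty: "dom D \<inter> dom A = {} \<Longrightarrow> map_sign A D - map_sign D A = 0"
  unfolding map_sign_def by (simp add: Int_commute)

lemma bond_coeff_nonzero: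
  assumes "bond_coeff D A B \<noteq> 0"
  shows "B = map_mult D A" "A = map_mult D B" "dom D \<inter> dom A \<noteq> {}" "dom D \<inter> dom B \<noteq> {}"
proof -
  show 1: "B = map_mult D A" using assms by (auto simp: bond_coeff_def split: if_splits)
  then show "A = map_mult D B" by (simp add: map_mult_cancel)
  have ne: "map_sign A D \<noteq> map_sign D A" using assms by (auto simp: bond_coeff_def split: if_splits)
  then show "dom D \<inter> dom A \<noteq> {}" using map_sign_Int_empty[of D A] by auto
  from ne have "\<exists>u\<in>dom A \<inter> dom D. site_sign (A u) (D u) \<noteq> site_sign (D u) (A u)"
    unfolding map_sign_def by (metis (mono_tags, lifting) Int_commute prod.cong)
  then obtain u where u: "u \<in> dom D" "site_sign (A u) (D u) \<noteq> site_sign (D u) (A u)" by blast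
  then have "A u \<noteq> D u" by auto
  then have "u \<in> dom B" using 1 by (simp add: domIff map_mult_def site_mult_eq_None)
  with u show "dom D \<inter> dom B \<noteq> {}" by blast
qed

lemma bond_coeff_expansion:
  assumes D: "finite (dom D)" and A: "finite (dom A)"
  shows "pauli_expansion (\<lambda>\<psi> \<sigma>. pauli_op A (pauli_op D \<psi>) \<sigma> - pauli_op D (pauli_op A \<psi>) \<sigma>)
           (bond_coeff D A)"
proof -
  let ?I = "{B. bond_coeff D A B \<noteq> 0}"
  have I: "B \<in> ?I \<Longrightarrow> B = map_mult D A" for B using bond_coeff_nonzero(1) by blast
  have fin: "finite (dom (map_mult D A))"
    by (rule finite_subset[OF dom_map_mult]) (use A D in simp)
  have comm: "pauli_op A (pauli_op D \<psi>) \<sigma> - pauli_op D (pauli_op A \<psi>) \<sigma>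
      = (\<Sum>B\<in>?I. bond_coeff D A B * pauli_op B \<psi> \<sigma>)" for \<psi> \<sigma>
  proof -
    have "(\<Sum>B\<in>?I. bond_coeff D A B * pauli_op B \<psi> \<sigma>)
        = (\<Sum>B\<in>{map_mult D A}. bond_coeff D A B * pauli_op B \<psi> \<sigma>)"
      by (rule sum.mono_neutral_left) (use I in auto)
    also have "\<dots> = (map_sign A D - map_sign D A) * pauli_op (map_mult D A) \<psi> \<sigma>"
      by (simp add: bond_coeff_def)
    finally show ?thesis
      by (simp add: pauli_op_mult A D map_mult_commute[of A D] left_diff_distrib)
  qed
  show ?thesis
  proof (rule pauli_expansionI[where I = ?I])
    show "finite ?I" by (rule finite_subset[of _ "{map_mult D A}"]) (use I in auto)
    show "?I \<subseteq> pauli_products"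
    proof
      fix B assume "B \<in> ?I"
      then show "B \<in> pauli_products"
        using bond_coeff_nonzero(4)[of D A B] I[of B] fin by (auto simp: pauli_products_def)
    qed
  qed (use comm in auto)
qed

lemma pauli_op_uminus_sum:
  fixes f :: "'i \<Rightarrow> ('d::finite) config \<Rightarrow> complex"
  assumes "finite (dom A)"
  shows "pauli_op A (\<lambda>\<sigma>. - (\<Sum>i\<in>J. f i \<sigma>)) \<sigma> = - (\<Sum>i\<in>J. pauli_op A (f i) \<sigma>)"
  by (simp add: pauli_op_apply assms sum_distrib_left)

definition comm_sites :: "('d::finite) pauli_map \<Rightarrow> 'd site set" where
  "comm_sites A = {u. xx_local_supp u \<inter> dom A \<noteq> {}}"

lemma finite_comm_sites:
  assumes "finite (dom A)"
  shows "finite (comm_sites A)"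
proof -
  have "comm_sites A \<subseteq> dom A \<union> (\<Union>\<alpha>. (\<lambda>v. v - unit_vec \<alpha>) ` dom A)"
  proof
    fix u assume "u \<in> comm_sites A"
    then consider "u \<in> dom A" | \<alpha> where "u + unit_vec \<alpha> \<in> dom A"
      by (auto simp: comm_sites_def xx_local_supp_def)
    then show "u \<in> dom A \<union> (\<Union>\<alpha>. (\<lambda>v. v - unit_vec \<alpha>) ` dom A)"
    proof cases
      case 2
      then have "u \<in> (\<lambda>v. v - unit_vec \<alpha>) ` dom A" by (intro image_eqI[of _ _ "u + unit_vec \<alpha>"]) auto
      then show ?thesis by blast
    qed simp
  qed
  moreover have "finite (dom A \<union> (\<Union>\<alpha>. (\<lambda>v. v - unit_vec \<alpha>) ` dom A))" using assms by simp
  ultimately show ?thesis by (rule finite_subset)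
qed

lemma xx_commutator_expansion:
  assumes A: "finite (dom A)"
  shows "pauli_expansion (commutator (xx_local u) (pauli_op A))
           (\<lambda>B. \<Sum>\<alpha>\<in>UNIV. bond_coeff (bond u \<alpha> PX) A B + bond_coeff (bond u \<alpha> PY) A B)"
proof -
  let ?T = "\<lambda>D \<psi> \<sigma>. pauli_op A (pauli_op D \<psi>) \<sigma> - pauli_op D (pauli_op A \<psi>) \<sigma>"
  have fin: "finite (dom (bond u \<alpha> p))" for \<alpha> p by (simp add: dom_bond)
  have xx: "xx_local u \<psi> = (\<lambda>\<sigma>. - (\<Sum>\<alpha>\<in>UNIV. pauli_op (bond u \<alpha> PX) \<psi> \<sigma> + pauli_op (bond u \<alpha> PY) \<psi> \<sigma>))" for \<psi>
    by (rule ext) (simp add: xx_local_def bond_def)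
  have "commutator (xx_local u) (pauli_op A)
      = (\<lambda>\<psi> \<sigma>. \<Sum>\<alpha>\<in>UNIV. ?T (bond u \<alpha> PX) \<psi> \<sigma> + ?T (bond u \<alpha> PY) \<psi> \<sigma>)"
  proof (intro ext)
    fix \<psi> \<sigma>
    have "pauli_op A (xx_local u \<psi>) \<sigma> = - (\<Sum>\<alpha>\<in>UNIV. pauli_op A (pauli_op (bond u \<alpha> PX) \<psi>) \<sigma>
        + pauli_op A (pauli_op (bond u \<alpha> PY) \<psi>) \<sigma>)"
      unfolding xx pauli_op_uminus_sum[OF A]
      by (simp add: pauli_op_apply[OF A] distrib_left)
    then show "commutator (xx_local u) (pauli_op A) \<psi> \<sigma>
        = (\<Sum>\<alpha>\<in>UNIV. ?T (bond u \<alpha> PX) \<psi> \<sigma> + ?T (bond u \<alpha> PY) \<psi> \<sigma>)"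
      unfolding commutator_def xx[of "pauli_op A \<psi>"] by (simp add: sum.distrib sum_subtractf)
  qed
  then show ?thesis
    using fin by (simp add: pauli_expansion_sum pauli_expansion_add bond_coeff_expansion A)
qed

lemma comm_H_expansion_explicit:
  assumes A: "finite (dom A)"
  shows "pauli_expansion (comm_H A) (\<lambda>B. \<Sum>u\<in>comm_sites A. \<Sum>\<alpha>\<in>UNIV.
           bond_coeff (bond u \<alpha> PX) A B + bond_coeff (bond u \<alpha> PY) A B)"
proof -
  have "comm_H A = (\<lambda>\<psi> \<sigma>. \<Sum>u\<in>comm_sites A. commutator (xx_local u) (pauli_op A) \<psi> \<sigma>)"
    by (intro ext) (simp add: comm_H_def comm_sites_def)
  then show ?thesis
    using pauli_expansion_sum[OF finite_comm_sites[OF A] xx_commutator_expansion[OF A]] by simp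
qed

theorem comm_H_expansion:
  assumes "A \<in> pauli_products"
  shows "\<exists>!c. pauli_expansion (comm_H A) c"
proof -
  have "finite (dom A)" using assms by (simp add: pauli_products_def)
  note expansion = comm_H_expansion_explicit[OF this]
  show ?thesis
    by (rule ex1I, rule expansion) (rule pauli_expansion_unique[OF _ expansion])
qed

lemma comm_coeff_eq:
  assumes "A \<in> pauli_products"
  shows "comm_coeff A B = (\<Sum>u\<in>comm_sites A. \<Sum>\<alpha>\<in>UNIV.
           bond_coeff (bond u \<alpha> PX) A B + bond_coeff (bond u \<alpha> PY) A B)"
proof -
  have "pauli_expansion (comm_H A) (comm_coeff A)"
    unfolding comm_coeff_def by (rule theI'[OF comm_H_expansion[OF assms]])
  moreover have "finite (dom A)" using assms by (simp add: pauli_products_def)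
  ultimately show ?thesis
    using fun_cong[OF pauli_expansion_unique[OF _ comm_H_expansion_explicit]] by blast
qed

theorem finite_comm_coeff_nonzero:
  fixes B :: "('d::finite) pauli_map"
  assumes "B \<in> pauli_products"
  shows "finite {A. A \<in> pauli_products \<and> comm_coeff A B \<noteq> 0}"
proof -
  have B: "finite (dom B)" using assms by (simp add: pauli_products_def)
  let ?N = "(\<lambda>(u, \<alpha>, p). map_mult (bond u \<alpha> p) B) ` (comm_sites B \<times> UNIV \<times> {PX, PY})"
  have "{A. A \<in> pauli_products \<and> comm_coeff A B \<noteq> 0} \<subseteq> ?N"
  proof
    fix A assume "A \<in> {A. A \<in> pauli_products \<and> comm_coeff A B \<noteq> 0}"
    then have "(\<Sum>u\<in>comm_sites A. \<Sum>\<alpha>\<in>UNIV.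
        bond_coeff (bond u \<alpha> PX) A B + bond_coeff (bond u \<alpha> PY) A B) \<noteq> 0"
      using comm_coeff_eq[of A B] by simp
    then obtain u \<alpha> where "bond_coeff (bond u \<alpha> PX) A B + bond_coeff (bond u \<alpha> PY) A B \<noteq> 0"
      by (meson sum.not_neutral_contains_not_neutral)
    then obtain p where p: "p \<in> {PX, PY}" "bond_coeff (bond u \<alpha> p) A B \<noteq> 0"
      by (metis add.right_neutral insertCI)
    have "u \<in> comm_sites B"
      using bond_coeff_nonzero(4)[OF p(2)] by (auto simp: dom_bond comm_sites_def xx_local_supp_def)
    then have "(u, \<alpha>, p) \<in> comm_sites B \<times> UNIV \<times> {PX, PY}" using p(1) by simp
    then show "A \<in> ?N"
      by (rule rev_image_eqI) (use bond_coeff_nonzero(2)[OF p(2)] in simp)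
  qed
  moreover have "finite ?N" using finite_comm_sites[OF B] by simp
  ultimately show ?thesis by (rule finite_subset)
qed

end

(* A conserved quantity satisfies one linear equation for every product B, relating the products DB
   where D is a bond of the Hamiltonian anticommuting with B. Suppose the coefficients of width
   greater than k are bounded by M, and let A have width k in some direction. Extending A by a bond
   at one end gives an equation whose only other term of width at most k is A shifted by one site;
   it is present only if the opposite end of A is a single X or Y, with a different Pauli matrix next
   to it. Shifting A repeatedly, its coefficient is O(k^(d+1) M) unless A is a straight string P Z ... Z R with
   P, R in {X, Y}. To treat strings, attach to a Z of the string a bump in a perpendicular
   direction. The equations of the bumped string, one for each position of the string relative to the
   bump, telescope, and their sum bounds about k times the coefficient of the string by
   O(k^(d+3) M). Altogether the coefficients of width k are O(k^(d+2) M), hence at most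
   4 d^2 (k+1)^(d+3) M for k >= 22. Iterating from width k to infinity, the decay of F forces all
   coefficients of width at least 22 to vanish, so the quantity is local. *)

theory Submission
  imports Defs
begin

subsection \<open>Linear equations indexed by products\<close>

text \<open>Bonds carry only X or Y. A bond deletes a site only by matching its Pauli matrix, and
  its other end must then hold a different one. This rigidity makes all but a few products in an
  equation wide. A quasi-local quantity has no largest width to descend from, so wide terms are
  merely bounded by M, and every equation costs a factor counting its terms: at most 4d per site of
  the support (2d neighbours, X or Y). A product of width k may fill a box of k^d sites, which puts
  d into the exponent.

  Strings are the obstacle. A shift turns a string into a string with X and Y exchanged at both
  ends, so the equations of width k + 1 only relate strings to one another. In one dimension such
  strings do build conserved quantities, those of the free-fermion XX chain. The perpendicular
  direction breaks this, and here d >= 2 enters: with a bump, every unwanted product has width k and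
  leaves its row, so it is already known to be small. The two terms that survive the telescoping are
  each controlled by one copy of the coefficient, so that k - 4 copies remain of the k - 2 interior
  positions.\<close>

lemma site_mult_assoc: "site_mult (site_mult a b) c = site_mult a (site_mult b c)"
  by (cases a rule: pauli_option_cases; cases b rule: pauli_option_cases;
      cases c rule: pauli_option_cases) simp_all

lemma map_mult_assoc: "map_mult (map_mult A B) C = map_mult A (map_mult B C)"
  by (rule ext) (simp add: map_mult_def site_mult_assoc)

lemma map_mult_left_commute: "map_mult A (map_mult B C) = map_mult B (map_mult A C)"
  by (metis map_mult_assoc map_mult_commute)

text \<open>Undirected, unlike \<open>bond\<close>, so that arguments can be reflected along an
  axis; \<open>edges_eq_bonds\<close> reconciles the two descriptions.\<close>

definition nbr :: "('d::finite) site \<Rightarrow> 'd site \<Rightarrow> bool" where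
  "nbr u v \<longleftrightarrow> (\<exists>\<gamma> s. (s = 1 \<or> s = -1) \<and> v = u + axis \<gamma> s)"

definition edge :: "('d::finite) site \<Rightarrow> 'd site \<Rightarrow> pauli \<Rightarrow> 'd pauli_map" where
  "edge u v p = [u \<mapsto> p, v \<mapsto> p]"

definition edges :: "('d::finite) pauli_map set" where
  "edges = {edge u v p | u v p. nbr u v \<and> p \<noteq> PZ}"

text \<open>One-site phase of the product of \<open>p b\<close> with \<open>p\<close>: it is 1 if
  \<open>p\<close> and \<open>b\<close> commute and \<open>\<i>\<close> or \<open>- \<i>\<close> if
  they anticommute.\<close>

definition edge_phase :: "pauli \<Rightarrow> pauli option \<Rightarrow> complex" where
  "edge_phase p b = site_sign (site_mult (Some p) b) (Some p)"

text \<open>The coefficient \<open>\<lambda>\<^bsub>DB,B\<^esub>\<close> is \<open>2 \<i> comm_sign D B\<close>.\<close>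

definition comm_sign :: "('d::finite) pauli_map \<Rightarrow> 'd pauli_map \<Rightarrow> real" where
  "comm_sign D B = Im (map_sign (map_mult D B) D)"

text \<open>These are the edges anticommuting with \<open>B\<close>: the two end phases multiply to
  an imaginary number exactly when one end anticommutes and the other does not.\<close>

definition adj :: "('d::finite) pauli_map \<Rightarrow> 'd pauli_map set" where
  "adj B = {D \<in> edges. comm_sign D B \<noteq> 0}"

lemma axis_minus: "axis \<gamma> (- s) = - axis \<gamma> (s::int)"
  by (simp add: axis_def vec_eq_iff)

lemma nbr_sym: "nbr u v \<Longrightarrow> nbr v u"
  unfolding nbr_def
proof (elim exE conjE)
  fix \<gamma> s assume "s = 1 \<or> s = - 1" and v: "v = u + axis \<gamma> s"
  then show "\<exists>\<gamma> s. (s = 1 \<or> s = - 1) \<and> u = v + axis \<gamma> s"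
    by (intro exI[of _ \<gamma>] exI[of _ "-s"]) (auto simp: axis_minus)
qed

lemma nbr_neq: "nbr u v \<Longrightarrow> u \<noteq> v"
  by (auto simp: nbr_def axis_eq_0_iff)

lemma edge_commute: "edge u v p = edge v u p"
  by (auto simp: edge_def fun_upd_def fun_eq_iff)

lemma edge_apply: "edge u v p x = (if x = u \<or> x = v then Some p else None)"
  by (simp add: edge_def)

lemma dom_edge: "dom (edge u v p) = {u, v}"
  by (auto simp: edge_def)

lemma edge_mem_edges: "nbr u v \<Longrightarrow> p \<noteq> PZ \<Longrightarrow> edge u v p \<in> edges"
  by (auto simp: edges_def)

lemma finite_dom_edges: "D \<in> edges \<Longrightarrow> finite (dom D)"
  by (auto simp: edges_def dom_edge)

lemma finite_dom_map_mult: "finite (dom A) \<Longrightarrow> finite (dom B) \<Longrightarrow> finite (dom (map_mult A B))"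
  by (rule finite_subset[OF dom_map_mult]) simp

lemma bond_eq_edge: "bond u \<alpha> p = edge u (u + unit_vec \<alpha>) p"
  by (simp add: bond_def edge_def)

lemma nbr_unit_vec: "nbr u (u + unit_vec \<gamma>)"
  by (auto simp: nbr_def unit_vec_def)

lemma edges_eq_bonds: "edges = {bond u \<gamma> p | u \<gamma> p. p \<noteq> PZ}" (is "_ = ?R")
proof
  show "?R \<subseteq> edges"
    by (auto simp: bond_eq_edge intro!: edge_mem_edges nbr_unit_vec)
  show "edges \<subseteq> ?R"
  proof
    fix D :: "'a pauli_map" assume "D \<in> edges"
    then obtain u v p \<gamma> s where D: "D = edge u v p" "p \<noteq> PZ" "s = 1 \<or> s = -1" "v = u + axis \<gamma> s"
      unfolding edges_def nbr_def by blast
    from D(3) show "D \<in> ?R"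
    proof
      assume "s = 1"
      then have "D = bond u \<gamma> p" using D by (simp add: bond_eq_edge unit_vec_def)
      then show ?thesis using D by blast
    next
      assume "s = -1"
      then have "D = bond v \<gamma> p" using D
        by (simp add: bond_eq_edge unit_vec_def axis_minus edge_commute[of u])
      then show ?thesis using D by blast
    qed
  qed
qed

lemma bond_inject:
  assumes "bond u \<gamma> p = bond v \<delta> p'"
  shows "u = v \<and> \<gamma> = \<delta> \<and> p = p'"
proof -
  have doms: "{u, u + unit_vec \<gamma>} = {v, v + unit_vec \<delta>}"
    using arg_cong[OF assms, of dom] by (simp add: dom_bond)
  have p: "p = p'"
    using fun_cong[OF assms, of u] by (auto simp: bond_def split: if_splits)
  have "u = v"
  proof (rule ccontr)
    assume "u \<noteq> v"
    then have "u = v + unit_vec \<delta>" "v = u + unit_vec \<gamma>" using doms by (auto simp: doubleton_eq_iff)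
    then have "unit_vec \<delta> + unit_vec \<gamma> = (0 :: 'a site)" by (simp add: algebra_simps)
    then have "(unit_vec \<delta> + unit_vec \<gamma> :: 'a site) $ \<delta> = 0" by simp
    then show False by (simp add: unit_vec_def axis_def split: if_splits)
  qed
  then have "unit_vec \<gamma> = (unit_vec \<delta> :: 'a site)" using doms by (auto simp: doubleton_eq_iff)
  then have "\<gamma> = \<delta>" by (simp add: unit_vec_def axis_eq_axis)
  with \<open>u = v\<close> p show ?thesis by simp
qed

lemma edge_phase_simps [simp]:
  "edge_phase p None = 1" "edge_phase p (Some p) = 1"
  "edge_phase PX (Some PY) = \<i>" "edge_phase PX (Some PZ) = - \<i>"
  "edge_phase PY (Some PX) = - \<i>" "edge_phase PY (Some PZ) = \<i>"
  by (cases p; simp add: edge_phase_def)+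

text \<open>Reversing the order of the factors conjugates the phase, so the commutator keeps twice
  the imaginary part; this is why \<open>comm_sign\<close> is an \<open>Im\<close>.\<close>

lemma map_sign_edge:
  assumes "u \<noteq> v"
  shows "map_sign (map_mult (edge u v p) B) (edge u v p) = edge_phase p (B u) * edge_phase p (B v)"
    and "map_sign (edge u v p) (map_mult (edge u v p) B) = cnj (edge_phase p (B u) * edge_phase p (B v))"
proof -
  have *: "site_sign (Some p) (site_mult (Some p) b) = cnj (edge_phase p b)" for b
    by (cases p; cases b rule: pauli_option_cases) (simp_all add: edge_phase_def)
  have "map_sign (map_mult (edge u v p) B) (edge u v p)
      = (\<Prod>x\<in>{u, v}. site_sign (map_mult (edge u v p) B x) (edge u v p x))"
    by (rule map_sign_superset) (auto simp: dom_edge)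
  then show "map_sign (map_mult (edge u v p) B) (edge u v p) = edge_phase p (B u) * edge_phase p (B v)"
    using assms by (simp add: map_mult_def edge_apply edge_phase_def)
  have "map_sign (edge u v p) (map_mult (edge u v p) B)
      = (\<Prod>x\<in>{u, v}. site_sign (edge u v p x) (map_mult (edge u v p) B x))"
    by (rule map_sign_superset) (auto simp: dom_edge)
  then show "map_sign (edge u v p) (map_mult (edge u v p) B) = cnj (edge_phase p (B u) * edge_phase p (B v))"
    using assms by (simp add: map_mult_def edge_apply *)
qed

lemma comm_sign_edge:
  "u \<noteq> v \<Longrightarrow> comm_sign (edge u v p) B = Im (edge_phase p (B u) * edge_phase p (B v))"
  by (simp add: comm_sign_def map_sign_edge)

lemma bond_coeff_comm_sign:
  assumes "D \<in> edges"
  shows "bond_coeff D (map_mult D B) B = 2 * \<i> * comm_sign D B"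
proof -
  obtain u v p where D: "D = edge u v p" and "nbr u v" using assms by (auto simp: edges_def)
  then have uv: "u \<noteq> v" by (simp add: nbr_neq)
  show ?thesis
    by (simp add: D bond_coeff_def map_mult_cancel map_sign_edge[OF uv] comm_sign_edge[OF uv]
        complex_eq_iff)
qed

lemma abs_comm_sign:
  assumes "D \<in> adj B"
  shows "\<bar>comm_sign D B\<bar> = 1"
proof -
  have D: "D \<in> edges" and nz: "comm_sign D B \<noteq> 0" using assms by (auto simp: adj_def)
  obtain u v p where D: "D = edge u v p" and "nbr u v" using D by (auto simp: edges_def)
  then have uv: "u \<noteq> v" by (simp add: nbr_neq)
  have ph: "edge_phase p b \<in> {1, \<i>, -\<i>}" for b
    by (cases p; cases b rule: pauli_option_cases) (simp_all add: edge_phase_def)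
  show ?thesis using nz ph[of "B u"] ph[of "B v"] by (auto simp: D comm_sign_edge[OF uv])
qed

lemma edge_phase_eq_1_iff: "edge_phase p b = 1 \<longleftrightarrow> b = None \<or> b = Some p"
  by (cases p; cases b rule: pauli_option_cases) (simp_all add: edge_phase_def complex_eq_iff)

lemma Im_edge_phase: "b \<noteq> None \<Longrightarrow> b \<noteq> Some p \<Longrightarrow> Im (edge_phase p b) \<noteq> 0"
  by (cases p; cases b rule: pauli_option_cases) (simp_all add: edge_phase_def)

section \<open>Conservation as one linear equation over anticommuting edges\<close>

lemma adj_map_mult:
  assumes "D \<in> adj B" "finite (dom B)"
  shows "map_mult D B \<in> pauli_products"
proof -
  have "bond_coeff D (map_mult D B) B \<noteq> 0" and D: "D \<in> edges"
    using assms by (auto simp: adj_def bond_coeff_comm_sign)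
  from bond_coeff_nonzero(3)[OF this(1)] have "dom (map_mult D B) \<noteq> {}" by blast
  then show ?thesis
    using assms D by (simp add: pauli_products_def finite_dom_map_mult finite_dom_edges)
qed

text \<open>Multiplication by a bond is an involution up to phase, so only the bond
  \<open>map_mult A B\<close> can connect the two products, and by \<open>bond_inject\<close> it
  occurs once in the double sum.\<close>

lemma comm_coeff_edges:
  assumes A: "A \<in> pauli_products"
  shows "comm_coeff A B = (if map_mult A B \<in> edges then bond_coeff (map_mult A B) A B else 0)"
proof -
  let ?D = "map_mult A B"
  have other: "bond_coeff (bond u \<gamma> p) A B = 0" if "bond u \<gamma> p \<noteq> ?D" for u \<gamma> p
  proof (rule ccontr)
    assume "bond_coeff (bond u \<gamma> p) A B \<noteq> 0"
    then have "B = map_mult (bond u \<gamma> p) A" by (rule bond_coeff_nonzero)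
    then have "?D = bond u \<gamma> p" by (metis map_mult_cancel map_mult_commute)
    then show False using that by simp
  qed
  show ?thesis
  proof (cases "?D \<in> edges")
    case False
    have "bond u \<gamma> p \<noteq> ?D" if "p \<noteq> PZ" for u \<gamma> p
    proof -
      have "bond u \<gamma> p \<in> edges" unfolding edges_eq_bonds using that by blast
      then show ?thesis using False by auto
    qed
    then show ?thesis using False other by (simp add: comm_coeff_eq[OF A])
  next
    case True
    then obtain v \<delta> p where D: "?D = bond v \<delta> p" and p: "p \<noteq> PZ" unfolding edges_eq_bonds by blast
    have fin: "finite (comm_sites A)" using A by (simp add: finite_comm_sites pauli_products_def)
    have inner: "(\<Sum>\<gamma>\<in>UNIV. bond_coeff (bond u \<gamma> PX) A B + bond_coeff (bond u \<gamma> PY) A B)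
        = (if u = v then bond_coeff ?D A B else 0)" for u
    proof -
      have "bond_coeff (bond u \<gamma> PX) A B + bond_coeff (bond u \<gamma> PY) A B
          = (if \<gamma> = \<delta> then (if u = v then bond_coeff ?D A B else 0) else 0)" for \<gamma>
      proof (cases "u = v \<and> \<gamma> = \<delta>")
        case False
        then have "bond u \<gamma> p' \<noteq> ?D" for p' unfolding D using bond_inject[of u \<gamma> p' v \<delta> p] by auto
        then show ?thesis using False other by auto
      next
        case True
        have "bond u \<gamma> p' \<noteq> ?D" if "p' \<noteq> p" for p' unfolding D using bond_inject[of u \<gamma> p' v \<delta> p] that by auto
        then have "bond_coeff (bond u \<gamma> p') A B = 0" if "p' \<noteq> p" for p' using other that by blast
        then show ?thesis using True p unfolding D by (cases p) auto
      qed
      then show ?thesis by simp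
    qed
    have "v \<in> comm_sites A \<or> bond_coeff ?D A B = 0"
      using bond_coeff_nonzero(3)[of ?D A B] unfolding D
      by (auto simp: comm_sites_def xx_local_supp_def dom_bond)
    then show ?thesis using True fin by (auto simp: comm_coeff_eq[OF A] inner)
  qed
qed

lemma adj_subset:
  "adj B \<subseteq> (\<lambda>(u, \<gamma>, s, p). edge u (u + axis \<gamma> s) p) ` (dom B \<times> UNIV \<times> {1, -1} \<times> {PX, PY})"
    (is "_ \<subseteq> ?f ` ?X")
proof
  fix D assume D: "D \<in> adj B"
  then obtain u v p where Duv: "D = edge u v p" and uv: "nbr u v" and p: "p \<noteq> PZ"
    by (auto simp: adj_def edges_def)
  have "u \<in> dom B \<or> v \<in> dom B"
  proof (rule ccontr)
    assume "\<not> (u \<in> dom B \<or> v \<in> dom B)"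
    then have "B u = None" "B v = None" by (simp_all add: domIff)
    then show False using D comm_sign_edge[OF nbr_neq[OF uv], of p B] by (simp add: adj_def Duv)
  qed
  then obtain x y where xy: "D = edge x y p" "nbr x y" "x \<in> dom B"
    using that[of u v] that[of v u] Duv uv nbr_sym[OF uv] edge_commute[of u v p] by auto
  then obtain \<gamma> s where "s = 1 \<or> s = -1" "y = x + axis \<gamma> s" by (auto simp: nbr_def)
  then show "D \<in> ?f ` ?X"
    using xy p by (intro image_eqI[of _ _ "(x, \<gamma>, s, p)"]) (cases p; auto)+
qed

text \<open>An anticommuting edge must touch the support. Each site has two neighbours per
  direction, and each of these edges carries X or Y, whence the factor 4 per direction.\<close>

lemma
  fixes B :: "('d::finite) pauli_map"
  assumes "finite (dom B)"
  shows finite_adj: "finite (adj B)"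
    and card_adj: "card (adj B) \<le> 4 * CARD('d) * card (dom B)"
proof -
  let ?X = "dom B \<times> (UNIV :: 'd set) \<times> {1, -1 :: int} \<times> {PX, PY}"
  have X: "finite ?X" using assms by simp
  show "finite (adj B)" by (rule finite_surj[OF X adj_subset])
  have "card (adj B) \<le> card ?X" using surj_card_le[OF X adj_subset] .
  then show "card (adj B) \<le> 4 * CARD('d) * card (dom B)" by (simp add: card_cartesian_product algebra_simps)
qed

lemma conserved_coeff_adj:
  assumes B: "B \<in> pauli_products"
  shows "conserved_coeff q B = 2 * \<i> * (\<Sum>D\<in>adj B. complex_of_real (comm_sign D B) * q (map_mult D B))"
proof -
  have fin: "finite (dom B)" using B by (simp add: pauli_products_def)
  have cancel: "map_mult (map_mult A B) B = A" for A by (metis map_mult_cancel map_mult_commute)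
  have coeff: "comm_coeff (map_mult D B) B = 2 * \<i> * comm_sign D B" if "D \<in> adj B" for D
    using that adj_map_mult[OF that fin]
    by (simp add: comm_coeff_edges cancel adj_def bond_coeff_comm_sign)
  have "(\<Sum>D\<in>adj B. 2 * \<i> * comm_sign D B * q (map_mult D B)) = conserved_coeff q B"
    unfolding conserved_coeff_def
  proof (rule sum.reindex_bij_witness[where i = "\<lambda>A. map_mult A B" and j = "\<lambda>D. map_mult D B"])
    fix D assume D: "D \<in> adj B"
    then show "map_mult D B \<in> {A. A \<in> pauli_products \<and> comm_coeff A B \<noteq> 0}"
      using adj_map_mult[OF D fin] coeff[OF D] by (simp add: adj_def)
    show "comm_coeff (map_mult D B) B * q (map_mult D B) = 2 * \<i> * comm_sign D B * q (map_mult D B)"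
      by (simp add: coeff[OF D])
  next
    fix A assume A: "A \<in> {A. A \<in> pauli_products \<and> comm_coeff A B \<noteq> 0}"
    then have "map_mult A B \<in> edges" "bond_coeff (map_mult A B) A B \<noteq> 0"
      using comm_coeff_edges[of A B] by (auto split: if_splits)
    then show "map_mult A B \<in> adj B"
      using bond_coeff_comm_sign[of "map_mult A B" B] by (auto simp: adj_def cancel)
  qed (simp_all add: cancel)
  then show ?thesis by (simp add: sum_distrib_left mult.assoc)
qed

text \<open>To cancel the matrix at \<open>w\<close> the edge must equal it there, hence commute
  there. The anticommutation then happens at \<open>v\<close>, where \<open>B\<close> holds a
  different matrix, and so \<open>v\<close> survives. In particular no edge deletes a Z.\<close>

lemma removed_site:
  assumes D: "D \<in> adj B" and w: "w \<in> dom B" "w \<notin> dom (map_mult D B)"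
  obtains v p where "D = edge w v p" "nbr w v" "p \<noteq> PZ" "B w = Some p" "v \<in> dom B" "B v \<noteq> Some p"
    "v \<in> dom (map_mult D B)"
proof -
  have Dw: "D w = B w" using w(2) by (simp add: map_mult_def site_mult_eq_None domIff)
  obtain u v' p where D': "D = edge u v' p" "nbr u v'" "p \<noteq> PZ"
    using D by (auto simp: adj_def edges_def)
  then consider "w = u" | "w = v'" using Dw w by (auto simp: edge_apply domIff split: if_splits)
  then obtain v where v: "D = edge w v p" "nbr w v"
  proof cases
    case 1
    then show ?thesis using that D' by blast
  next
    case 2
    then show ?thesis using that[of u] D' nbr_sym[of u v'] edge_commute[of u v' p] by simp
  qed
  have wv: "w \<noteq> v" using v nbr_neq by blast
  have Bw: "B w = Some p" using Dw v by (simp add: edge_apply)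
  have "Im (edge_phase p (B v)) \<noteq> 0"
    using D comm_sign_edge[OF wv, of p B] by (simp add: adj_def v Bw)
  then have "edge_phase p (B v) \<noteq> 1" by auto
  then have Bv: "B v \<noteq> None" "B v \<noteq> Some p" by (auto simp: edge_phase_eq_1_iff)
  then have "v \<in> dom (map_mult D B)"
    by (auto simp: domIff map_mult_def site_mult_eq_None v edge_apply simp del: not_None_eq)
  then show ?thesis using that v D' Bw Bv by blast
qed

text \<open>All coefficients of the exact equation have modulus 1, so everything outside
  \<open>K\<close> can be moved to the error. \<open>K\<close> may contain edges that commute with
  \<open>B\<close>; they contribute zero, which avoids case distinctions later.\<close>

lemma approx_conserved:
  fixes q :: "('d::finite) candidate" and \<epsilon> :: real
  assumes q: "conserved_coeff q B = 0" and B: "B \<in> pauli_products"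
    and K: "finite K" "K \<subseteq> edges"
    and small: "\<And>D. D \<in> adj B \<Longrightarrow> D \<notin> K \<Longrightarrow> norm (q (map_mult D B)) \<le> \<epsilon>"
    and card: "card (dom B) \<le> n" and "0 \<le> \<epsilon>"
  shows "norm (\<Sum>D\<in>K. complex_of_real (comm_sign D B) * q (map_mult D B)) \<le> 4 * CARD('d) * n * \<epsilon>"
proof -
  let ?g = "\<lambda>D. complex_of_real (comm_sign D B) * q (map_mult D B)"
  have finB: "finite (dom B)" using B by (simp add: pauli_products_def)
  note fin = finite_adj[OF finB]
  have K_eq: "sum ?g K = sum ?g (K \<inter> adj B)"
    by (rule sum.mono_neutral_right) (use K in \<open>auto simp: adj_def\<close>)
  have "2 * \<i> * sum ?g (adj B) = 0" using q conserved_coeff_adj[OF B, of q] by simp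
  then have "sum ?g (adj B) = 0" by simp
  moreover have "sum ?g (adj B) = sum ?g (adj B \<inter> K) + sum ?g (adj B - K)"
    by (rule sum.Int_Diff[OF fin])
  ultimately have "sum ?g K = - sum ?g (adj B - K)"
    unfolding K_eq by (simp add: Int_commute add_eq_0_iff2)
  then have "norm (sum ?g K) = norm (sum ?g (adj B - K))" by simp
  also have "\<dots> \<le> (\<Sum>D\<in>adj B - K. norm (?g D))" by (rule norm_sum)
  also have "\<dots> \<le> (\<Sum>D\<in>adj B - K. \<epsilon>)"
    by (rule sum_mono) (use small in \<open>auto simp: norm_mult abs_comm_sign\<close>)
  also have "\<dots> = card (adj B - K) * \<epsilon>" by simp
  also have "\<dots> \<le> (4 * CARD('d) * n) * \<epsilon>"
  proof (rule mult_right_mono)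
    have "card (adj B - K) \<le> card (adj B)" by (simp add: card_mono fin)
    also have "\<dots> \<le> 4 * CARD('d) * card (dom B)" by (rule card_adj[OF finB])
    also have "\<dots> \<le> 4 * CARD('d) * n" using card by simp
    finally show "real (card (adj B - K)) \<le> 4 * CARD('d) * n" using of_nat_mono by fastforce
  qed fact
  finally show ?thesis by simp
qed

subsection \<open>Shifting\<close>

lemma axis_apply: "axis \<alpha> s $ \<gamma> = (if \<gamma> = \<alpha> then s else 0)"
  by (simp add: axis_def)

lemma nbr_axis: "s = 1 \<or> s = -1 \<Longrightarrow> nbr u (u + axis \<alpha> s)"
  by (auto simp: nbr_def)

lemma nbr_height_less:
  assumes "nbr u v" and s: "s = 1 \<or> s = -1" and less: "s * u $ \<alpha> < s * v $ \<alpha>"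
  shows "v = u + axis \<alpha> s"
proof -
  obtain \<gamma> t where t: "t = 1 \<or> t = -1" and v: "v = u + axis \<gamma> t"
    using assms(1) by (auto simp: nbr_def)
  have "0 < s * axis \<gamma> t $ \<alpha>" using less by (simp add: v distrib_left)
  then have "\<gamma> = \<alpha> \<and> t = s" using s t by (auto simp: axis_apply split: if_splits)
  then show ?thesis using v by simp
qed

definition same_row :: "'d::finite \<Rightarrow> 'd site \<Rightarrow> 'd site \<Rightarrow> bool" where
  "same_row \<alpha> w x \<longleftrightarrow> (\<forall>\<gamma>. \<gamma> \<noteq> \<alpha> \<longrightarrow> x $ \<gamma> = w $ \<gamma>)"

definition extremal :: "'d::finite \<Rightarrow> int \<Rightarrow> nat \<Rightarrow> 'd site \<Rightarrow> 'd site \<Rightarrow> 'd pauli_map \<Rightarrow> bool" where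
  "extremal \<alpha> s k w u A \<longleftrightarrow> w \<in> dom A \<and> u \<in> dom A \<and> s * u $ \<alpha> = s * w $ \<alpha> + int k - 1 \<and>
     (\<forall>x\<in>dom A. s * w $ \<alpha> \<le> s * x $ \<alpha> \<and> s * x $ \<alpha> \<le> s * u $ \<alpha>)"

lemma extremal_reflect: "extremal \<alpha> s k w u A \<Longrightarrow> extremal \<alpha> (- s) k u w A"
  unfolding extremal_def by (smt (verit) mult_minus_left)

lemma same_row_eqI:
  assumes "same_row \<alpha> w x" "same_row \<alpha> w y" "s * x $ \<alpha> = s * y $ \<alpha>" and s: "s = 1 \<or> s = (-1 :: int)"
  shows "x = y"
proof -
  have "x $ \<gamma> = y $ \<gamma>" for \<gamma>
    using assms by (cases "\<gamma> = \<alpha>") (auto simp: same_row_def)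
  then show ?thesis by (simp add: vec_eq_iff)
qed

text \<open>A string in direction \<open>\<alpha>\<close> through \<open>w\<close>; positions are counted from \<open>w\<close> with orientation \<open>s\<close>,
  so that reflecting the axis amounts to negating \<open>s\<close>, \<open>l\<close> and \<open>r\<close>.\<close>

definition line :: "'d::finite \<Rightarrow> int \<Rightarrow> 'd site \<Rightarrow> int \<Rightarrow> pauli \<Rightarrow> int \<Rightarrow> pauli \<Rightarrow> 'd pauli_map" where
  "line \<alpha> s w l P r R x = (if same_row \<alpha> w x then
     (let i = s * x $ \<alpha> - s * w $ \<alpha> in
       if i = l then Some P else if i = r then Some R else if l < i \<and> i < r then Some PZ else None)
     else None)"

text \<open>\<open>M\<close> bounds the coefficients of all products of width greater than \<open>k\<close>; the aim is to bound
  those of width \<open>k\<close> by a polynomial multiple of \<open>M\<close>.\<close>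

locale nearly_conserved =
  fixes q :: "('d::finite) candidate" and k :: nat and M :: real
  assumes conserved: "B \<in> pauli_products \<Longrightarrow> conserved_coeff q B = 0"
    and wide_pos: "A \<in> pauli_products \<Longrightarrow> u \<in> dom A \<Longrightarrow> v \<in> dom A \<Longrightarrow> int k \<le> v $ \<gamma> - u $ \<gamma>
      \<Longrightarrow> norm (q A) \<le> M"
    and M_nonneg: "0 \<le> M"
    and k_ge: "8 \<le> k"
begin

lemma wide:
  assumes "A \<in> pauli_products" "u \<in> dom A" "v \<in> dom A" "s = 1 \<or> s = -1"
    "int k \<le> s * v $ \<alpha> - s * u $ \<alpha>"
  shows "norm (q A) \<le> M"
  using assms(4)
proof
  assume "s = 1"
  then show ?thesis using assms wide_pos[of A u v \<alpha>] by simp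
next
  assume "s = -1"
  then show ?thesis using assms wide_pos[of A v u \<alpha>] by simp
qed

text \<open>Multiplying by a bond that sticks out beyond the extremal site \<open>u\<close> gives a product \<open>B\<close> of width
  \<open>k + 1\<close>. Apart from \<open>A\<close>, the equation of \<open>B\<close> contains at most one product that is not wider
  than \<open>k\<close>, namely the one obtained by deleting the opposite extremal site \<open>w\<close>.\<close>

lemma shift:
  fixes n :: nat
  assumes A: "A \<in> pauli_products" and card: "card (dom A) \<le> n" and s: "s = 1 \<or> s = -1"
    and ext: "extremal \<alpha> s k w u A" and big: "4 * CARD('d) * (n + 1) * M < norm (q A)"
  obtains p p' A' where "p \<noteq> PZ" "p' \<noteq> PZ" "A w = Some p'" "A (w + axis \<alpha> s) \<noteq> None"
    "A (w + axis \<alpha> s) \<noteq> Some p'" "\<forall>x\<in>dom A. s * x $ \<alpha> = s * w $ \<alpha> \<longrightarrow> x = w"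
    "A' = map_mult (edge w (w + axis \<alpha> s) p') (map_mult (edge u (u + axis \<alpha> s) p) A)"
    "A' \<in> pauli_products" "card (dom A') \<le> n" "extremal \<alpha> s k (w + axis \<alpha> s) (u + axis \<alpha> s) A'"
    "norm (q A) \<le> norm (q A') + 4 * CARD('d) * (n + 1) * M"
proof -
  define u' where "u' = u + axis \<alpha> s"
  define w' where "w' = w + axis \<alpha> s"
  have ss: "s * s = 1" using s by auto
  have ht: "s * u' $ \<alpha> = s * u $ \<alpha> + 1" "s * w' $ \<alpha> = s * w $ \<alpha> + 1"
    by (simp_all add: u'_def w'_def axis_apply distrib_left ss)
  have w: "w \<in> dom A" and u: "u \<in> dom A" and uw: "s * u $ \<alpha> = s * w $ \<alpha> + int k - 1"
    and between: "\<And>x. x \<in> dom A \<Longrightarrow> s * w $ \<alpha> \<le> s * x $ \<alpha> \<and> s * x $ \<alpha> \<le> s * u $ \<alpha>"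
    using ext by (auto simp: extremal_def)
  have neq: "w \<noteq> u" "w \<noteq> u'" "w' \<noteq> u" "w' \<noteq> u'" "u \<noteq> u'" "w \<noteq> w'"
    using uw ht k_ge by auto
  \<comment> \<open>The choice must differ from \<open>A u\<close>, so that the new edge
    anticommutes and \<open>u\<close> stays in the support.\<close>
  define p where "p = (if A u = Some PX then PY else PX)"
  have p: "p \<noteq> PZ" "A u \<noteq> Some p" by (auto simp: p_def)
  define D0 where "D0 = edge u u' p"
  define B where "B = map_mult D0 A"
  have B_other: "B x = A x" if "x \<noteq> u" "x \<noteq> u'" for x
    using that by (simp add: B_def map_mult_def D0_def edge_apply)
  have "u' \<notin> dom A" using between[of u'] ht by auto
  then have Bu': "B u' = Some p"
    by (simp add: B_def map_mult_def D0_def edge_apply domIff site_mult_commute)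
  have Bu: "B u \<noteq> None" "B u \<noteq> Some p"
  proof -
    have eq: "B u = site_mult (Some p) (A u)" by (simp add: B_def map_mult_def D0_def edge_apply)
    then show "B u \<noteq> None" using p by (auto simp: site_mult_eq_None)
    show "B u \<noteq> Some p"
    proof
      assume "B u = Some p"
      then have "A u = site_mult (Some p) (Some p)" using eq site_mult_cancel by metis
      then show False using u by (auto simp: site_mult_eq_None domIff)
    qed
  qed
  have DB0: "map_mult D0 B = A" by (simp add: B_def map_mult_cancel)
  have D0_edge: "D0 \<in> edges"
    unfolding D0_def u'_def by (rule edge_mem_edges[OF nbr_axis[OF s] p(1)])
  have D0: "D0 \<in> adj B"
    using D0_edge Im_edge_phase[OF Bu] comm_sign_edge[OF neq(5), of p B] by (simp add: adj_def D0_def Bu')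
  have domB: "dom B \<subseteq> insert u' (dom A)"
  proof
    fix x assume "x \<in> dom B"
    then show "x \<in> insert u' (dom A)" using u by (cases "x = u \<or> x = u'") (auto simp: B_other)
  qed
  have finA: "finite (dom A)" using A by (simp add: pauli_products_def)
  have cardB: "card (dom B) \<le> n + 1"
    using card_mono[OF _ domB] finA card card_insert_le_m1 card_insert_if[OF finA, of u'] by (auto split: if_splits)
  have finB: "finite (dom B)" using domB finA by (simp add: finite_subset)
  have B: "B \<in> pauli_products" using finB Bu' by (auto simp: pauli_products_def)
  have wB: "w \<in> dom B" using w neq by (simp add: domIff B_other)
  have claim: "(\<exists>p'. p' \<noteq> PZ \<and> D = edge w w' p' \<and> B w = Some p') \<and> B w' \<noteq> None \<and> B w' \<noteq> B w
      \<and> (\<forall>x\<in>dom A. s * x $ \<alpha> = s * w $ \<alpha> \<longrightarrow> x = w)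
      \<and> u' \<in> dom (map_mult D B) \<and> w' \<in> dom (map_mult D B)"
    if D: "D \<in> adj B" "D \<noteq> D0" and Dbig: "M < norm (q (map_mult D B))" for D
  proof -
    let ?A = "map_mult D B"
    have prod: "?A \<in> pauli_products" by (rule adj_map_mult[OF D(1) finB])
    have narrow: "s * y $ \<alpha> < s * x $ \<alpha> + int k" if "x \<in> dom ?A" "y \<in> dom ?A" for x y
      using wide[OF prod that s, of \<alpha>] Dbig by linarith
    \<comment> \<open>The new site can only be deleted through a neighbour in the support. The rest
      of the support is strictly lower, so this neighbour is \<open>u\<close> and the edge is
      \<open>D0\<close>. Once \<open>u'\<close> stays, the layer of \<open>w\<close>, which lies
      \<open>k\<close> below it, must disappear completely.\<close>
    have u'D: "u' \<in> dom ?A"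
    proof (rule ccontr)
      assume "u' \<notin> dom ?A"
      moreover have "u' \<in> dom B" using Bu' by auto
      ultimately obtain v p'' where v: "D = edge u' v p''" "nbr u' v" "B u' = Some p''" "v \<in> dom B"
        using removed_site[OF D(1)] by metis
      have "v \<in> dom A" using v(4) domB nbr_neq[OF v(2)] by auto
      then have "s * v $ \<alpha> < s * u' $ \<alpha>" using between[of v] ht by simp
      then have "u' = v + axis \<alpha> s" by (rule nbr_height_less[OF nbr_sym[OF v(2)] s])
      then have "v = u" by (simp add: u'_def)
      then have "D = D0" using v(1,3) Bu' by (simp add: D0_def edge_commute)
      then show False using D by simp
    qed
    have "w \<notin> dom ?A" using narrow[OF _ u'D, of w] ht uw by auto
    then obtain v p' where v: "D = edge w v p'" "nbr w v" "p' \<noteq> PZ" "B w = Some p'" "v \<in> dom B"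
        "B v \<noteq> Some p'" "v \<in> dom ?A"
      using removed_site[OF D(1) wB] by metis
    have "s * w $ \<alpha> < s * v $ \<alpha>" using narrow[OF v(7) u'D] ht uw by simp
    then have v': "v = w'" unfolding w'_def by (rule nbr_height_less[OF v(2) s])
    have "x = w" if x: "x \<in> dom A" "s * x $ \<alpha> = s * w $ \<alpha>" for x
    proof (rule ccontr)
      assume "x \<noteq> w"
      moreover have "x \<noteq> u" "x \<noteq> u'" "x \<noteq> w'" using x ht uw k_ge by auto
      ultimately have "?A x = A x" by (simp add: map_mult_def v(1) v' edge_apply B_other)
      then have "x \<in> dom ?A" using x by (simp add: domIff)
      then show False using narrow[OF _ u'D, of x] x ht uw by simp
    qed
    then show ?thesis using v v' u'D by auto
  qed
  have "\<exists>D1 \<in> adj B. D1 \<noteq> D0 \<and> M < norm (q (map_mult D1 B))"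
  proof (rule ccontr)
    assume no: "\<not> ?thesis"
    have small: "norm (q (map_mult D B)) \<le> M" if "D \<in> adj B" "D \<notin> {D0}" for D
      using no that by force
    have "norm (\<Sum>D\<in>{D0}. complex_of_real (comm_sign D B) * q (map_mult D B)) \<le> 4 * CARD('d) * (n + 1) * M"
      by (rule approx_conserved[OF conserved[OF B] B _ _ small cardB M_nonneg]) (use D0_edge in auto)
    then show False using big abs_comm_sign[OF D0] by (simp add: DB0 norm_mult)
  qed
  then obtain D1 where D1: "D1 \<in> adj B" "D1 \<noteq> D0" "M < norm (q (map_mult D1 B))" by blast
  from claim[OF D1] obtain p' where p': "p' \<noteq> PZ" "D1 = edge w w' p'" "B w = Some p'" by blast
  let ?A' = "map_mult D1 B"
  have small: "norm (q (map_mult D B)) \<le> M" if "D \<in> adj B" "D \<notin> {D0, D1}" for D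
  proof (rule ccontr)
    assume "\<not> ?thesis"
    then have "D = D1" using claim[of D] that p' by auto
    then show False using that by simp
  qed
  have "norm (\<Sum>D\<in>{D0, D1}. complex_of_real (comm_sign D B) * q (map_mult D B)) \<le> 4 * CARD('d) * (n + 1) * M"
    by (rule approx_conserved[OF conserved[OF B] B _ _ small cardB M_nonneg])
      (use D0 D1 in \<open>auto simp: adj_def\<close>)
  then have "norm (comm_sign D0 B * q A + comm_sign D1 B * q ?A') \<le> 4 * CARD('d) * (n + 1) * M"
    using D1(2) by (simp add: DB0 del: of_nat_mult of_nat_add)
  moreover have "norm (comm_sign D0 B * q A) = norm (q A)"
    "norm (comm_sign D1 B * q ?A') = norm (q ?A')"
    using abs_comm_sign[OF D0] abs_comm_sign[OF D1(1)] by (simp_all add: norm_mult)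
  ultimately have le: "norm (q A) \<le> norm (q ?A') + 4 * CARD('d) * (n + 1) * M"
    using norm_diff_ineq[of "comm_sign D0 B * q A" "comm_sign D1 B * q ?A'"] by linarith
  have Bw: "B w = A w" "B w' = A w'" using neq by (auto simp: B_other)
  have single: "\<forall>x\<in>dom A. s * x $ \<alpha> = s * w $ \<alpha> \<longrightarrow> x = w" using claim[OF D1] by blast
  \<comment> \<open>The support gains at most \<open>u'\<close> and loses \<open>w\<close>, so the
    size bound \<open>n\<close> survives any number of shifts.\<close>
  have domA': "dom ?A' \<subseteq> insert u' (dom A - {w})"
  proof
    fix x assume x: "x \<in> dom ?A'"
    show "x \<in> insert u' (dom A - {w})"
    proof (cases "x = w \<or> x = w'")
      case True
      moreover have "?A' w = None" by (simp add: map_mult_def p' edge_apply site_mult_eq_None)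
      moreover have "w' \<in> dom A" using claim[OF D1] Bw by auto
      ultimately show ?thesis using x neq by auto
    next
      case False
      then have "x \<in> dom B" using x by (simp add: map_mult_def p' edge_apply domIff)
      then show ?thesis using domB False by auto
    qed
  qed
  have "card (dom ?A') \<le> card (insert u' (dom A - {w}))" by (rule card_mono[OF _ domA']) (use finA in simp)
  also have "\<dots> \<le> Suc (card (dom A - {w}))" using finA by (simp add: card_insert_if)
  also have "\<dots> = card (dom A)" using card_Suc_Diff1[OF finA w] .
  finally have cardA': "card (dom ?A') \<le> n" using card by simp
  have extA': "extremal \<alpha> s k w' u' ?A'"
    unfolding extremal_def
  proof (intro conjI ballI)
    show "w' \<in> dom ?A'" "u' \<in> dom ?A'" using claim[OF D1] by auto
    show "s * u' $ \<alpha> = s * w' $ \<alpha> + int k - 1" using ht uw by simp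
    fix x assume "x \<in> dom ?A'"
    then have x: "x = u' \<or> x \<in> dom A \<and> x \<noteq> w" using domA' by auto
    then show "s * x $ \<alpha> \<le> s * u' $ \<alpha>" using between[of x] ht by fastforce
    show "s * w' $ \<alpha> \<le> s * x $ \<alpha>" using x
    proof
      assume "x = u'"
      then show ?thesis using ht uw k_ge by simp
    next
      assume x: "x \<in> dom A \<and> x \<noteq> w"
      then have "s * x $ \<alpha> \<noteq> s * w $ \<alpha>" using single by blast
      moreover have "s * w $ \<alpha> \<le> s * x $ \<alpha>" using between x by blast
      ultimately show ?thesis using ht(2) by linarith
    qed
  qed
  show thesis
  proof (rule that[of p p' ?A'])
    show "A w = Some p'" "A (w + axis \<alpha> s) \<noteq> None" "A (w + axis \<alpha> s) \<noteq> Some p'"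
      using claim[OF D1] p' Bw unfolding w'_def by auto
    show "?A' = map_mult (edge w (w + axis \<alpha> s) p') (map_mult (edge u (u + axis \<alpha> s) p) A)"
      by (simp add: p'(2) B_def D0_def u'_def w'_def)
    show "?A' \<in> pauli_products" by (rule adj_map_mult[OF D1(1) finB])
  qed (use p p' single cardA' extA' le in \<open>simp_all add: u'_def w'_def\<close>)
qed

text \<open>Each shift moves the second layer into the extremal position, so that a coefficient that
  survives \<open>j + 1\<close> shifts determines \<open>j + 1\<close> layers.\<close>

lemma prefix_of_large:
  fixes n :: nat
  assumes s: "s = 1 \<or> s = -1"
    and "A \<in> pauli_products" "card (dom A) \<le> n" "extremal \<alpha> s k w u A" "j + 2 \<le> k"
    and "real (j + 1) * (4 * CARD('d) * (n + 1) * M) < norm (q A)"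
  shows "(\<exists>P. P \<noteq> PZ \<and> A w = Some P) \<and> (\<forall>x\<in>dom A. s * x $ \<alpha> = s * w $ \<alpha> \<longrightarrow> x = w) \<and>
    (\<forall>x. s * w $ \<alpha> < s * x $ \<alpha> \<and> s * x $ \<alpha> \<le> s * w $ \<alpha> + int j \<longrightarrow>
      A x = (if same_row \<alpha> w x then Some PZ else None))"
  using assms(2-)
proof (induction j arbitrary: A w u)
  case 0
  obtain p' where "p' \<noteq> PZ" "A w = Some p'" "\<forall>x\<in>dom A. s * x $ \<alpha> = s * w $ \<alpha> \<longrightarrow> x = w"
    by (rule shift[OF 0(1,2) s 0(3)]) (use 0 in auto)
  then show ?case by auto
next
  case (Suc j)
  let ?c = "4 * CARD('d) * (n + 1) * M"
  have c: "0 \<le> ?c" using M_nonneg by simp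
  have "?c \<le> real (Suc j + 1) * ?c" using c mult_right_mono[of 1 "real (Suc j + 1)" ?c] by simp
  then have big: "?c < norm (q A)" using Suc.prems(5) by linarith
  define w' where "w' = w + axis \<alpha> s"
  define u' where "u' = u + axis \<alpha> s"
  obtain p p' A' where p: "p \<noteq> PZ" "p' \<noteq> PZ" "A w = Some p'" "A w' \<noteq> None"
    "A w' \<noteq> Some p'" and single: "\<forall>x\<in>dom A. s * x $ \<alpha> = s * w $ \<alpha> \<longrightarrow> x = w"
    and A': "A' = map_mult (edge w w' p') (map_mult (edge u u' p) A)"
    "A' \<in> pauli_products" "card (dom A') \<le> n" and ext': "extremal \<alpha> s k w' u' A'"
    and le: "norm (q A) \<le> norm (q A') + ?c"
    unfolding w'_def u'_def by (rule shift[OF Suc.prems(1,2) s Suc.prems(3) big]) blast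
  have "real (Suc j + 1) * ?c = real (j + 1) * ?c + ?c" by (simp add: algebra_simps)
  then have "real (j + 1) * ?c < norm (q A')" using Suc.prems(5) le by linarith
  then have IH: "(\<exists>P. P \<noteq> PZ \<and> A' w' = Some P)" "(\<forall>x\<in>dom A'. s * x $ \<alpha> = s * w' $ \<alpha> \<longrightarrow> x = w')"
    and IHZ: "\<And>x. s * w' $ \<alpha> < s * x $ \<alpha> \<Longrightarrow> s * x $ \<alpha> \<le> s * w' $ \<alpha> + int j \<Longrightarrow>
      A' x = (if same_row \<alpha> w' x then Some PZ else None)"
    using Suc.IH[OF A'(2,3) ext'] Suc.prems(4) by auto
  have ss: "s * s = 1" using s by auto
  have ht: "s * u' $ \<alpha> = s * u $ \<alpha> + 1" "s * w' $ \<alpha> = s * w $ \<alpha> + 1" "s * u $ \<alpha> = s * w $ \<alpha> + int k - 1"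
    using Suc.prems(3) by (simp_all add: u'_def w'_def axis_apply distrib_left ss extremal_def)
  have row: "same_row \<alpha> w' x = same_row \<alpha> w x" for x
    by (simp add: same_row_def w'_def axis_apply)
  have Z: "A x = (if same_row \<alpha> w x then Some PZ else None)"
    if x: "s * w $ \<alpha> < s * x $ \<alpha>" "s * x $ \<alpha> \<le> s * w $ \<alpha> + int (Suc j)" for x
  proof (cases "x = w'")
    case True
    have neq: "w' \<noteq> u" "w' \<noteq> u'" "w' \<noteq> w" using ht k_ge by auto
    have "A' w' = site_mult (Some p') (A w')"
      using neq by (simp add: A'(1) map_mult_def edge_apply)
    then obtain P where "P \<noteq> PZ" "site_mult (Some p') (A w') = Some P" using IH(1) by auto
    \<comment> \<open>After the shift \<open>w'\<close> must carry X or Y for a further shift to be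
      possible. As it holds neither the identity nor \<open>p'\<close> beforehand, only Z is
      left.\<close>
    then have "A w' = Some PZ" using p(2,4,5)
      by (cases p'; cases "A w'" rule: pauli_option_cases) auto
    moreover have "same_row \<alpha> w w'" by (simp add: same_row_def w'_def axis_apply)
    ultimately show ?thesis using True by simp
  next
    case False
    moreover have "x \<noteq> w" "x \<noteq> u" "x \<noteq> u'" using x ht Suc.prems(4) by auto
    ultimately have Ax: "A' x = A x" by (simp add: A'(1) map_mult_def edge_apply)
    show ?thesis
    proof (cases "s * x $ \<alpha> = s * w' $ \<alpha>")
      case True
      then have "A x = None" using IH(2) False Ax by (metis domIff)
      moreover have "\<not> same_row \<alpha> w' x"
        using same_row_eqI[of \<alpha> w' x w' s] True False s by (auto simp: same_row_def)
      ultimately show ?thesis by (simp add: row)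
    next
      case False
      then show ?thesis using IHZ[of x] x ht Ax by (simp add: row)
    qed
  qed
  show ?case using p(2,3) single Z by auto
qed

text \<open>The prefix with \<open>j = k - 2\<close> fixes every layer but the last. That one comes
  from a single shift in the opposite orientation, where \<open>u\<close> is the end to be deleted
  and hence a lone X or Y.\<close>

lemma line_of_large:
  fixes n :: nat
  assumes s: "s = 1 \<or> s = -1"
    and A: "A \<in> pauli_products" and card: "card (dom A) \<le> n" and ext: "extremal \<alpha> s k w u A"
    and big: "real k * (4 * CARD('d) * (n + 1) * M) < norm (q A)"
  obtains P R where "P \<noteq> PZ" "R \<noteq> PZ" "A = line \<alpha> s w 0 P (int k - 1) R"
proof -
  let ?c = "4 * CARD('d) * (n + 1) * M"
  have c: "0 \<le> ?c" using M_nonneg by simp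
  have le: "?c \<le> k * ?c" using mult_right_mono[OF _ c, of 1 "real k"] k_ge by simp
  have le': "real (k - 2 + 1) * ?c \<le> k * ?c" by (rule mult_right_mono[OF _ c]) (use k_ge in simp)
  have k2: "k - 2 + 2 \<le> k" "int (k - 2) = int k - 2" using k_ge by auto
  from prefix_of_large[OF s A card ext k2(1) le_less_trans[OF le' big]]
  obtain P where P: "P \<noteq> PZ" "A w = Some P" and singleL: "\<And>x. x\<in>dom A \<Longrightarrow> s * x $ \<alpha> = s * w $ \<alpha> \<Longrightarrow> x = w"
    and Z: "\<And>x. s * w $ \<alpha> < s * x $ \<alpha> \<Longrightarrow> s * x $ \<alpha> \<le> s * w $ \<alpha> + int (k - 2) \<Longrightarrow>
      A x = (if same_row \<alpha> w x then Some PZ else None)"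
    by auto
  have s': "- s = 1 \<or> - s = -1" using s by auto
  obtain R where R: "R \<noteq> PZ" "A u = Some R" "A (u + axis \<alpha> (- s)) \<noteq> None"
    and singleR: "\<forall>x\<in>dom A. - s * x $ \<alpha> = - s * u $ \<alpha> \<longrightarrow> x = u"
    using shift[OF A card s' extremal_reflect[OF ext]] le big by (smt (verit, ccfv_threshold))
  have ss: "s * s = 1" using s by auto
  have between: "s * w $ \<alpha> \<le> s * x $ \<alpha> \<and> s * x $ \<alpha> \<le> s * u $ \<alpha>" if "x \<in> dom A" for x
    using ext that by (auto simp: extremal_def)
  have uw: "s * u $ \<alpha> = s * w $ \<alpha> + int k - 1" using ext by (simp add: extremal_def)
  have "s * (u + axis \<alpha> (- s)) $ \<alpha> = s * u $ \<alpha> - 1" by (simp add: axis_apply right_diff_distrib ss)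
  \<comment> \<open>The backward shift needs a neighbour of \<open>u\<close> in the support. It lies
    in a layer already known to meet the support only in the row of \<open>w\<close>, and this puts
    \<open>u\<close> into that row.\<close>
  then have "same_row \<alpha> w (u + axis \<alpha> (- s))"
    using Z[of "u + axis \<alpha> (- s)"] R(3) uw k2 k_ge by (auto split: if_splits)
  then have row_u: "same_row \<alpha> w u" by (simp add: same_row_def axis_apply)
  have row_w: "same_row \<alpha> w w" by (simp add: same_row_def)
  have "A x = line \<alpha> s w 0 P (int k - 1) R x" for x
  proof -
    consider "s * x $ \<alpha> < s * w $ \<alpha> \<or> s * x $ \<alpha> > s * u $ \<alpha>" | "s * x $ \<alpha> = s * w $ \<alpha>" | "s * x $ \<alpha> = s * u $ \<alpha>"
      | "s * w $ \<alpha> < s * x $ \<alpha>" "s * x $ \<alpha> < s * u $ \<alpha>" by linarith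
    then show ?thesis
    proof cases
      case 1
      then have "x \<notin> dom A" using between[of x] by linarith
      then show ?thesis using 1 uw k_ge by (auto simp: line_def domIff Let_def)
    next
      case 2
      show ?thesis
      proof (cases "x = w")
        case True
        then show ?thesis using P row_w by (simp add: line_def)
      next
        case False
        then have "\<not> same_row \<alpha> w x" using same_row_eqI[OF _ row_w 2 s] by blast
        moreover have "x \<notin> dom A" using singleL 2 False by blast
        ultimately show ?thesis by (simp add: line_def domIff)
      qed
    next
      case 3
      show ?thesis
      proof (cases "x = u")
        case True
        then show ?thesis using R row_u uw k_ge by (simp add: line_def)
      next
        case False
        then have "\<not> same_row \<alpha> w x" using same_row_eqI[OF _ row_u 3 s] by blast
        moreover have "x \<notin> dom A" using singleR 3 False by auto
        ultimately show ?thesis by (simp add: line_def domIff)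
      qed
    next
      case 4
      then show ?thesis using Z[of x] uw k2 by (auto simp: line_def Let_def)
    qed
  qed
  then show thesis using that P R by blast
qed

end

subsection \<open>Straight strings\<close>

lemma card_site_box:
  fixes S :: "('d::finite) site set"
  assumes "finite S" and narrow: "\<And>u v \<gamma>. u \<in> S \<Longrightarrow> v \<in> S \<Longrightarrow> v $ \<gamma> - u $ \<gamma> < int k"
  shows "card S \<le> k ^ CARD('d)"
proof (cases "S = {}")
  case False
  define m where "m \<gamma> = Min ((\<lambda>x. x $ \<gamma>) ` S)" for \<gamma>
  let ?P = "PiE (UNIV :: 'd set) (\<lambda>\<gamma>. {m \<gamma>..<m \<gamma> + int k})"
  have "S \<subseteq> vec_lambda ` ?P"
  proof
    fix x assume x: "x \<in> S"
    have "m \<gamma> \<le> x $ \<gamma> \<and> x $ \<gamma> < m \<gamma> + int k" for \<gamma>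
    proof -
      have "m \<gamma> \<in> (\<lambda>x. x $ \<gamma>) ` S" unfolding m_def using assms(1) False by (intro Min_in) auto
      then obtain y where "y \<in> S" "m \<gamma> = y $ \<gamma>" by auto
      moreover have "m \<gamma> \<le> x $ \<gamma>" unfolding m_def using assms(1) x by (intro Min_le) auto
      ultimately show ?thesis using narrow[OF _ x, of y \<gamma>] by auto
    qed
    then show "x \<in> vec_lambda ` ?P" by (intro image_eqI[of _ _ "vec_nth x"]) auto
  qed
  moreover have fin: "finite ?P" by (rule finite_PiE) auto
  ultimately have "card S \<le> card ?P" by (rule surj_card_le[rotated])
  also have "\<dots> = k ^ CARD('d)" by (simp add: card_PiE)
  finally show ?thesis .
qed simp

text \<open>The effect on an end of shortening a string: X or Y times the adjacent Z is the other
  one of the two, up to phase.\<close>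

fun other :: "pauli \<Rightarrow> pauli" where
  "other PX = PY" | "other PY = PX" | "other PZ = PZ"

text \<open>The value of \<open>comm_sign\<close> for an edge that removes the end \<open>P\<close>
  of a string next to a Z.\<close>

fun bond_sign :: "pauli \<Rightarrow> real" where
  "bond_sign PX = -1" | "bond_sign PY = 1" | "bond_sign PZ = 0"

lemma other_other [simp]: "other (other P) = P"
  by (cases P) simp_all

lemma other_eq_PZ [simp]: "other P = PZ \<longleftrightarrow> P = PZ"
  by (cases P) simp_all

lemma site_mult_PZ: "P \<noteq> PZ \<Longrightarrow> site_mult (Some P) (Some PZ) = Some (other P)"
  by (cases P) simp_all

lemma site_mult_self [simp]: "site_mult a a = None"
  by (simp add: site_mult_eq_None)

lemma site_mult_None_right [simp]: "site_mult a None = a"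
  by (simp add: site_mult_commute[of a])

lemma Im_edge_phase_PZ: "P \<noteq> PZ \<Longrightarrow> Im (edge_phase P (Some PZ)) = bond_sign P"
  by (cases P) simp_all

definition pt :: "'d::finite \<Rightarrow> int \<Rightarrow> 'd site \<Rightarrow> int \<Rightarrow> 'd site" where
  "pt \<alpha> s w i = w + axis \<alpha> (s * i)"

lemma pt_0 [simp]: "pt \<alpha> s w 0 = w"
  by (simp add: pt_def vec_eq_iff axis_apply)

lemma pt_reflect: "pt \<alpha> (- s) w i = pt \<alpha> s w (- i)"
  by (simp add: pt_def)

lemma pt_nth: "pt \<alpha> s w i $ \<gamma> = w $ \<gamma> + (if \<gamma> = \<alpha> then s * i else 0)"
  by (simp add: pt_def axis_apply)

lemma same_row_pt [simp]: "same_row \<alpha> w (pt \<alpha> s w i)"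
  by (simp add: same_row_def pt_nth)

lemma nbr_coordinate:
  assumes "nbr u v" "u $ \<alpha> \<noteq> v $ \<alpha>" "\<gamma> \<noteq> \<alpha>"
  shows "u $ \<gamma> = v $ \<gamma>"
  using assms by (auto simp: nbr_def axis_apply split: if_splits)

lemma line_reflect:
  "l \<noteq> r \<Longrightarrow> line \<alpha> (- s) w l P r R = line \<alpha> s w (- r) R (- l) P"
  by (rule ext) (auto simp: line_def Let_def)

lemma line_off_row: "\<not> same_row \<alpha> w x \<Longrightarrow> line \<alpha> s w l P r R x = None"
  by (simp add: line_def)

context
  fixes s :: int
  assumes s: "s = 1 \<or> s = -1"
begin

lemma pt_height: "s * pt \<alpha> s w i $ \<alpha> = s * w $ \<alpha> + i"
  using s by (auto simp: pt_nth algebra_simps)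

lemma pt_inject [simp]: "pt \<alpha> s w i = pt \<alpha> s w j \<longleftrightarrow> i = j"
  using pt_height by (metis add_left_cancel)

lemma pt_eq_iff [simp]: "pt \<alpha> s w i = w \<longleftrightarrow> i = 0" "w = pt \<alpha> s w i \<longleftrightarrow> i = 0"
  using pt_inject[of \<alpha> w i 0] by auto

lemma same_rowE:
  assumes "same_row \<alpha> w x"
  obtains i where "x = pt \<alpha> s w i"
proof -
  have "x = pt \<alpha> s w (s * x $ \<alpha> - s * w $ \<alpha>)"
    by (rule same_row_eqI[OF assms _ _ s]) (simp_all add: pt_height)
  then show thesis using that by blast
qed

lemma nbr_pt: "nbr (pt \<alpha> s w i) (pt \<alpha> s w (i + 1))"
  using s by (auto simp: nbr_def pt_def vec_eq_iff axis_apply algebra_simps intro!: exI[of _ \<alpha>] exI[of _ s])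

lemma nbr_pt_iff: "nbr (pt \<alpha> s w i) (pt \<alpha> s w j) \<longleftrightarrow> j = i + 1 \<or> j = i - 1"
proof
  assume n: "nbr (pt \<alpha> s w i) (pt \<alpha> s w j)"
  have step: "b = a + 1" if "nbr (pt \<alpha> s w a) (pt \<alpha> s w b)" "a < b" for a b
  proof -
    have "pt \<alpha> s w b = pt \<alpha> s w a + axis \<alpha> s"
      by (rule nbr_height_less[OF that(1) s]) (simp add: pt_height that)
    also have "\<dots> = pt \<alpha> s w (a + 1)" by (simp add: pt_def vec_eq_iff axis_apply algebra_simps)
    finally show ?thesis by simp
  qed
  have "i \<noteq> j" using nbr_neq[OF n] by auto
  then show "j = i + 1 \<or> j = i - 1"
    using step[of i j] step[of j i] n nbr_sym[OF n] by linarith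
next
  assume "j = i + 1 \<or> j = i - 1"
  then show "nbr (pt \<alpha> s w i) (pt \<alpha> s w j)"
    using nbr_pt[of \<alpha> w i] nbr_sym[OF nbr_pt[of \<alpha> w j]] by auto
qed

lemma line_pt:
  "line \<alpha> s w l P r R (pt \<alpha> s w i) =
     (if i = l then Some P else if i = r then Some R else if l < i \<and> i < r then Some PZ else None)"
  by (simp add: line_def pt_height)

lemma dom_line:
  assumes "l < r"
  shows "dom (line \<alpha> s w l P r R) = pt \<alpha> s w ` {l..r}"
proof
  show "pt \<alpha> s w ` {l..r} \<subseteq> dom (line \<alpha> s w l P r R)"
    by (auto simp: line_pt domIff)
  show "dom (line \<alpha> s w l P r R) \<subseteq> pt \<alpha> s w ` {l..r}"
  proof
    fix x assume x: "x \<in> dom (line \<alpha> s w l P r R)"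
    then have "same_row \<alpha> w x" using line_off_row[of \<alpha> w x] by fastforce
    then obtain i where i: "x = pt \<alpha> s w i" by (rule same_rowE)
    then have "i \<in> {l..r}" using x assms by (auto simp: domIff line_pt split: if_splits)
    then show "x \<in> pt \<alpha> s w ` {l..r}" using i by blast
  qed
qed

lemma card_dom_line: "l < r \<Longrightarrow> card (dom (line \<alpha> s w l P r R)) \<le> nat (r - l + 1)"
  by (simp add: dom_line) (rule order.trans[OF card_image_le]; simp)

lemma line_products: "l < r \<Longrightarrow> line \<alpha> s w l P r R \<in> pauli_products"
  by (simp add: pauli_products_def dom_line del: dom_eq_empty_conv)

lemma shrink_left:
  assumes "l + 1 < r" "P \<noteq> PZ"
  shows "map_mult (edge (pt \<alpha> s w l) (pt \<alpha> s w (l + 1)) P) (line \<alpha> s w l P r R)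
    = line \<alpha> s w (l + 1) (other P) r R"
proof (rule ext)
  fix x
  show "map_mult (edge (pt \<alpha> s w l) (pt \<alpha> s w (l + 1)) P) (line \<alpha> s w l P r R) x
    = line \<alpha> s w (l + 1) (other P) r R x"
  proof (cases "same_row \<alpha> w x")
    case True
    then obtain i where "x = pt \<alpha> s w i" by (rule same_rowE)
    then show ?thesis using assms by (auto simp: map_mult_def edge_apply line_pt site_mult_PZ)
  next
    case False
    then have "x \<noteq> pt \<alpha> s w i" for i by auto
    then show ?thesis using False by (simp add: map_mult_def edge_apply line_off_row)
  qed
qed

lemma shrink_right:
  assumes "l + 1 < r" "R \<noteq> PZ"
  shows "map_mult (edge (pt \<alpha> s w (r - 1)) (pt \<alpha> s w r) R) (line \<alpha> s w l P r R)
    = line \<alpha> s w l P (r - 1) (other R)"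
proof (rule ext)
  fix x
  show "map_mult (edge (pt \<alpha> s w (r - 1)) (pt \<alpha> s w r) R) (line \<alpha> s w l P r R) x
    = line \<alpha> s w l P (r - 1) (other R) x"
  proof (cases "same_row \<alpha> w x")
    case True
    then obtain i where "x = pt \<alpha> s w i" by (rule same_rowE)
    then show ?thesis using assms by (auto simp: map_mult_def edge_apply line_pt site_mult_PZ)
  next
    case False
    then have "x \<noteq> pt \<alpha> s w i" for i by auto
    then show ?thesis using False by (simp add: map_mult_def edge_apply line_off_row)
  qed
qed

lemma edge_pt_mem_edges: "P \<noteq> PZ \<Longrightarrow> edge (pt \<alpha> s w i) (pt \<alpha> s w (i + 1)) P \<in> edges"
  "P \<noteq> PZ \<Longrightarrow> edge (pt \<alpha> s w (i - 1)) (pt \<alpha> s w i) P \<in> edges"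
  using nbr_pt[of \<alpha> w i] nbr_pt[of \<alpha> w "i - 1"] by (auto intro: edge_mem_edges)

end

section \<open>Equations of straight strings and smallness off the row\<close>

context nearly_conserved
begin

text \<open>The threshold of \<open>line_of_large\<close> with \<open>n\<close> the number of sites
  in a box of side \<open>k\<close>.\<close>

definition off_row_bound :: real where
  "off_row_bound = real k * (4 * CARD('d) * (k ^ CARD('d) + 1) * M)"

lemma M_le_off_row_bound: "M \<le> off_row_bound"
proof -
  have "1 * M \<le> real (k * (4 * CARD('d) * (k ^ CARD('d) + 1))) * M"
  proof (rule mult_right_mono[OF _ M_nonneg])
    have "1 \<le> k * (4 * CARD('d) * (k ^ CARD('d) + 1))" using k_ge by (simp add: Suc_le_eq)
    then show "1 \<le> real (k * (4 * CARD('d) * (k ^ CARD('d) + 1)))" by linarith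
  qed
  then show ?thesis by (simp add: off_row_bound_def mult.assoc)
qed

text \<open>A coefficient above the threshold exceeds \<open>M\<close>, so the product is not wider
  than \<open>k\<close> in any direction. Its support then fits into a box, and \<open>w\<close> and
  \<open>u\<close> are extremal, as \<open>line_of_large\<close> requires.\<close>

lemma line_or_small:
  assumes A: "A \<in> pauli_products" and s: "s = 1 \<or> s = -1" and wu: "w \<in> dom A" "u \<in> dom A"
    and dist: "s * u $ \<alpha> - s * w $ \<alpha> = int k - 1" and big: "off_row_bound < norm (q A)"
  obtains P R where "P \<noteq> PZ" "R \<noteq> PZ" "A = line \<alpha> s w 0 P (int k - 1) R"
proof -
  have narrow_s: "t * y $ \<gamma> - t * x $ \<gamma> < int k" if "x \<in> dom A" "y \<in> dom A" "t = 1 \<or> t = -1" for x y \<gamma> t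
    using wide[OF A that, of \<gamma>] big M_le_off_row_bound by linarith
  have "card (dom A) \<le> k ^ CARD('d)"
  proof (rule card_site_box)
    show "finite (dom A)" using A by (simp add: pauli_products_def)
    show "v $ \<gamma> - u $ \<gamma> < int k" if "u \<in> dom A" "v \<in> dom A" for u v \<gamma>
      using narrow_s[OF that, of 1 \<gamma>] by simp
  qed
  moreover have "extremal \<alpha> s k w u A"
    unfolding extremal_def
  proof (intro conjI ballI wu)
    show "s * u $ \<alpha> = s * w $ \<alpha> + int k - 1" using dist by simp
    fix x assume "x \<in> dom A"
    then show "s * w $ \<alpha> \<le> s * x $ \<alpha>" "s * x $ \<alpha> \<le> s * u $ \<alpha>"
      using narrow_s[of x u s \<alpha>] narrow_s[of w x s \<alpha>] wu s dist by linarith+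
  qed
  ultimately show thesis
    using line_of_large[OF s A] big that unfolding off_row_bound_def by blast
qed

lemma off_row_small:
  assumes A: "A \<in> pauli_products" and s: "s = 1 \<or> s = -1" and wu: "w \<in> dom A" "u \<in> dom A"
    and dist: "s * u $ \<alpha> - s * w $ \<alpha> = int k - 1"
    and y: "y \<in> dom A" "\<gamma> \<noteq> \<alpha>" "y $ \<gamma> \<noteq> w $ \<gamma>"
  shows "norm (q A) \<le> off_row_bound"
proof (rule ccontr)
  assume "\<not> ?thesis"
  then have "off_row_bound < norm (q A)" by simp
  then obtain P R where "A = line \<alpha> s w 0 P (int k - 1) R"
    using line_or_small[OF A s wu dist] by metis
  then have "same_row \<alpha> w y" using y(1) line_off_row[of \<alpha> w y] by fastforce
  then show False using y by (simp add: same_row_def)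
qed

text \<open>The string on \<open>k + 1\<close> sites keeps both ends, and hence stays wide, under
  every other edge. The two remaining terms are a string of \<open>k\<close> sites and its shift by
  one site.\<close>

lemma line_relation:
  assumes s: "s = 1 \<or> s = -1" and PR: "P \<noteq> PZ" "R \<noteq> PZ" and r: "r = l + int k"
  shows "norm (bond_sign P * q (line \<alpha> s w (l + 1) (other P) r R)
      + bond_sign R * q (line \<alpha> s w l P (r - 1) (other R))) \<le> 4 * CARD('d) * (k + 2) * M"
proof -
  note [simp] = pt_inject[OF s]
  let ?pt = "pt \<alpha> s w"
  define B where "B = line \<alpha> s w l P r R"
  define Dl where "Dl = edge (?pt l) (?pt (l + 1)) P"
  define Dr where "Dr = edge (?pt (r - 1)) (?pt r) R"
  have lr: "l < r" "l + 1 < r" using r k_ge by auto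
  have B: "B \<in> pauli_products" unfolding B_def by (rule line_products[OF s lr(1)])
  have finB: "finite (dom B)" using B by (simp add: pauli_products_def)
  have card: "card (dom B) \<le> k + 2"
    using card_dom_line[OF s lr(1), of \<alpha> w P R] r by (simp add: B_def)
  have Dl: "Dl \<in> edges" and Dr: "Dr \<in> edges"
    unfolding Dl_def Dr_def by (rule edge_pt_mem_edges[OF s]; fact)+
  have neq: "Dl \<noteq> Dr"
  proof
    assume "Dl = Dr"
    then have "Dr (?pt l) = Dl (?pt l)" by simp
    then show False using lr by (simp add: Dl_def Dr_def edge_apply)
  qed
  have B_pt: "B (?pt i) = (if i = l then Some P else if i = r then Some R
      else if l < i \<and> i < r then Some PZ else None)" for i
    by (simp add: B_def line_pt[OF s])
  have domB: "dom B = ?pt ` {l..r}" unfolding B_def by (rule dom_line[OF s lr(1)])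
  have signs: "comm_sign Dl B = bond_sign P" "comm_sign Dr B = bond_sign R"
    using lr PR by (simp_all add: Dl_def Dr_def comm_sign_edge B_pt Im_edge_phase_PZ)
  have small: "norm (q (map_mult D B)) \<le> M" if D: "D \<in> adj B" "D \<notin> {Dl, Dr}" for D
  proof -
    have "?pt l \<in> dom (map_mult D B)"
    proof (rule ccontr)
      assume "?pt l \<notin> dom (map_mult D B)"
      moreover have "?pt l \<in> dom B" by (simp add: domIff B_pt)
      ultimately obtain v p where v: "D = edge (?pt l) v p" "nbr (?pt l) v" "B (?pt l) = Some p" "v \<in> dom B"
        using removed_site[OF D(1)] by metis
      then obtain j where "l \<le> j" "v = ?pt j" using domB by auto
      then have "D = Dl" using v nbr_pt_iff[OF s, of \<alpha> w l j] by (auto simp: Dl_def B_pt)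
      then show False using D by simp
    qed
    moreover have "?pt r \<in> dom (map_mult D B)"
    proof (rule ccontr)
      assume "?pt r \<notin> dom (map_mult D B)"
      moreover have "?pt r \<in> dom B" by (simp add: domIff B_pt)
      ultimately obtain v p where v: "D = edge (?pt r) v p" "nbr (?pt r) v" "B (?pt r) = Some p" "v \<in> dom B"
        using removed_site[OF D(1)] by metis
      then obtain j where "j \<le> r" "v = ?pt j" using domB by auto
      then have "D = Dr" using v nbr_pt_iff[OF s, of \<alpha> w r j] lr
        by (auto simp: Dr_def B_pt edge_commute[of "?pt r"])
      then show False using D by simp
    qed
    ultimately show ?thesis
      by (rule wide[OF adj_map_mult[OF D(1) finB] _ _ s, of _ _ \<alpha>]) (simp add: pt_height[OF s] r)
  qed
  have "norm (\<Sum>D\<in>{Dl, Dr}. complex_of_real (comm_sign D B) * q (map_mult D B)) \<le> 4 * CARD('d) * (k + 2) * M"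
    by (rule approx_conserved[OF conserved[OF B] B _ _ small card M_nonneg]) (use Dl Dr in auto)
  moreover have "map_mult Dl B = line \<alpha> s w (l + 1) (other P) r R"
    unfolding Dl_def B_def by (rule shrink_left[OF s lr(2) PR(1)])
  moreover have "map_mult Dr B = line \<alpha> s w l P (r - 1) (other R)"
    unfolding Dr_def B_def by (rule shrink_right[OF s lr(2) PR(2)])
  ultimately show ?thesis using neq signs by (simp del: of_nat_mult of_nat_add)
qed

end

subsection \<open>Strings with a bump\<close>

text \<open>The Y at \<open>w\<close> turns an interior Z into X, and an end X into Z. No edge can
  delete a Z, so in the second case that end contributes nothing to the equation.\<close>

definition bump_edge :: "'d::finite \<Rightarrow> 'd site \<Rightarrow> 'd pauli_map" where
  "bump_edge \<beta> w = edge w (w + axis \<beta> 1) PY"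

context
  fixes s :: int and \<alpha> \<beta> :: "'d::finite"
  assumes s: "s = 1 \<or> s = -1" and ne: "\<beta> \<noteq> \<alpha>"
begin

lemma pt_neq_bump: "pt \<alpha> s w i \<noteq> w + axis \<beta> 1" "w + axis \<beta> 1 \<noteq> pt \<alpha> s w i"
  using ne by (auto simp: vec_eq_iff pt_nth axis_apply)

lemma not_same_row_bump: "\<not> same_row \<alpha> w (w + axis \<beta> 1)"
  using ne by (auto simp: same_row_def axis_apply)

lemma nbr_bump:
  assumes "nbr (pt \<alpha> s w i) (w + axis \<beta> 1)"
  shows "i = 0"
proof (rule ccontr)
  assume "i \<noteq> 0"
  then have "pt \<alpha> s w i $ \<alpha> \<noteq> (w + axis \<beta> 1) $ \<alpha>" using s ne by (auto simp: pt_nth axis_apply)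
  from nbr_coordinate[OF assms this ne] show False using ne by (simp add: pt_nth axis_apply)
qed

lemma bump_line_apply:
  "map_mult (bump_edge \<beta> w) (line \<alpha> s w l P r R) (pt \<alpha> s w i) =
     (if i = 0 then site_mult (Some PY) (line \<alpha> s w l P r R w) else line \<alpha> s w l P r R (pt \<alpha> s w i))"
  "map_mult (bump_edge \<beta> w) (line \<alpha> s w l P r R) (w + axis \<beta> 1) = Some PY"
  by (auto simp: map_mult_def bump_edge_def edge_apply pt_neq_bump pt_eq_iff[OF s]
      line_off_row[OF not_same_row_bump])

lemma dom_bump_line:
  "l < r \<Longrightarrow> dom (map_mult (bump_edge \<beta> w) (line \<alpha> s w l P r R)) \<subseteq>
    insert (w + axis \<beta> 1) (insert w (pt \<alpha> s w ` {l..r}))"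
  using dom_map_mult[of "bump_edge \<beta> w" "line \<alpha> s w l P r R"]
  by (simp add: bump_edge_def dom_edge dom_line[OF s] insert_commute)

end

context nearly_conserved
begin

text \<open>The equation of a string with a bump leaves only three coefficients that are not small: the
  string without the bump, and the two strings with a bump that are shorter at one end. At a
  removed end next to the bump the factor \<open>comm_sign\<close> may vanish.\<close>

lemma bump_relation:
  fixes w :: "'d site"
  assumes s: "s = 1 \<or> s = -1" and ne: "\<beta> \<noteq> \<alpha>" and PR: "P \<noteq> PZ" "R \<noteq> PZ"
    and r: "r = l + int k - 1" "l \<le> 0" "0 \<le> r" "l = 0 \<Longrightarrow> P = PX" "r = 0 \<Longrightarrow> R = PX"
  defines "L \<equiv> line \<alpha> s w l P r R" and "B \<equiv> map_mult (bump_edge \<beta> w) (line \<alpha> s w l P r R)"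
    and "Dl \<equiv> edge (pt \<alpha> s w l) (pt \<alpha> s w (l + 1)) P"
    and "Dr \<equiv> edge (pt \<alpha> s w (r - 1)) (pt \<alpha> s w r) R"
  shows "norm (comm_sign Dl B * q (map_mult Dl B) + comm_sign Dr B * q (map_mult Dr B)
      + (if l = 0 \<or> r = 0 then 1 else - 1) * q L) \<le> 4 * CARD('d) * (k + 2) * off_row_bound"
proof -
  note [simp] = pt_inject[OF s] pt_eq_iff[OF s] pt_neq_bump[OF s ne]
  let ?pt = "pt \<alpha> s w" and ?top = "w + axis \<beta> 1" and ?Db = "bump_edge \<beta> w"
  have lr: "l < r" "l + 1 < r" using r k_ge by auto
  have L_pt: "L (?pt i) = (if i = l then Some P else if i = r then Some R
      else if l < i \<and> i < r then Some PZ else None)" for i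
    by (simp add: L_def line_pt[OF s])
  have Lw: "L w = (if l = 0 \<or> r = 0 then Some PX else Some PZ)"
    using L_pt[of 0] r by auto
  have B_pt: "B (?pt i) = (if i = 0 then if l = 0 \<or> r = 0 then Some PZ else Some PX else L (?pt i))" for i
    using bump_line_apply(1)[OF s ne, of w l P r R i] Lw by (simp add: B_def L_def)
  have Bw: "B w = (if l = 0 \<or> r = 0 then Some PZ else Some PX)" using B_pt[of 0] by simp
  have B_top: "B ?top = Some PY" using bump_line_apply(2)[OF s ne] by (simp add: B_def)
  have domB: "dom B \<subseteq> insert ?top (?pt ` {l..r})"
  proof -
    have "w \<in> ?pt ` {l..r}" using r by (intro image_eqI[of _ _ 0]) auto
    then show ?thesis using dom_bump_line[OF s ne lr(1), of w P R] by (auto simp: B_def simp del: domIff)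
  qed
  have in_B: "?pt l \<in> dom B" "?pt r \<in> dom B" "?top \<in> dom B"
    using lr by (auto simp: B_pt L_pt B_top)
  have finB: "finite (dom B)" using domB by (rule finite_subset) simp
  have B: "B \<in> pauli_products" using finB in_B by (auto simp: pauli_products_def)
  have card: "card (dom B) \<le> k + 2"
  proof -
    have "card (dom B) \<le> card (insert ?top (?pt ` {l..r}))" by (rule card_mono[OF _ domB]) simp
    also have "\<dots> \<le> Suc (card (?pt ` {l..r}))" by (simp add: card_insert_if)
    also have "\<dots> \<le> Suc (card {l..r})" using card_image_le[of "{l..r}" ?pt] by simp
    also have "\<dots> \<le> k + 2" using r by simp
    finally show ?thesis .
  qed
  have Dl: "Dl \<in> edges" and Dr: "Dr \<in> edges"
    unfolding Dl_def Dr_def by (rule edge_pt_mem_edges[OF s]; fact)+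
  have Db: "?Db \<in> edges"
    unfolding bump_edge_def by (rule edge_mem_edges[OF nbr_axis]) auto
  have "Dl (?pt r) \<noteq> Dr (?pt r)" "Dl ?top \<noteq> ?Db ?top" "Dr ?top \<noteq> ?Db ?top"
    using lr by (simp_all add: Dl_def Dr_def bump_edge_def edge_apply)
  then have neq: "Dl \<noteq> Dr" "Dl \<noteq> ?Db" "Dr \<noteq> ?Db" by auto
  have sign: "comm_sign ?Db B = (if l = 0 \<or> r = 0 then 1 else - 1)"
  proof -
    have "w \<noteq> ?top" by (simp add: axis_eq_0_iff)
    then show ?thesis by (simp add: bump_edge_def comm_sign_edge Bw B_top)
  qed
  have small: "norm (q (map_mult D B)) \<le> off_row_bound" if D: "D \<in> adj B" "D \<notin> {Dl, Dr, ?Db}" for D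
  proof -
    have "?pt l \<in> dom (map_mult D B)"
    proof (rule ccontr)
      assume "?pt l \<notin> dom (map_mult D B)"
      then obtain v p where v: "D = edge (?pt l) v p" "nbr (?pt l) v" "p \<noteq> PZ" "B (?pt l) = Some p" "v \<in> dom B"
        using removed_site[OF D(1) in_B(1)] by metis
      then have "l \<noteq> 0" by (auto simp: B_pt)
      then have "p = P" using v(4) by (simp add: B_pt L_pt)
      have "v \<noteq> ?top" using nbr_bump[OF s ne, of w l] v(2) \<open>l \<noteq> 0\<close> by auto
      then obtain j where "l \<le> j" "v = ?pt j" using domB v(5) by auto
      then have "D = Dl" using v nbr_pt_iff[OF s, of \<alpha> w l j] \<open>p = P\<close> by (auto simp: Dl_def)
      then show False using D by simp
    qed
    moreover have "?pt r \<in> dom (map_mult D B)"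
    proof (rule ccontr)
      assume "?pt r \<notin> dom (map_mult D B)"
      then obtain v p where v: "D = edge (?pt r) v p" "nbr (?pt r) v" "p \<noteq> PZ" "B (?pt r) = Some p" "v \<in> dom B"
        using removed_site[OF D(1) in_B(2)] by metis
      then have "r \<noteq> 0" by (auto simp: B_pt)
      then have "p = R" using v(4) lr by (simp add: B_pt L_pt)
      have "v \<noteq> ?top" using nbr_bump[OF s ne, of w r] v(2) \<open>r \<noteq> 0\<close> by auto
      then obtain j where "j \<le> r" "v = ?pt j" using domB v(5) by auto
      then have "D = Dr" using v nbr_pt_iff[OF s, of \<alpha> w r j] \<open>p = R\<close>
        by (auto simp: Dr_def edge_commute[of "?pt r"])
      then show False using D by simp
    qed
    moreover have "?top \<in> dom (map_mult D B)"
    proof (rule ccontr)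
      assume "?top \<notin> dom (map_mult D B)"
      then obtain v p where v: "D = edge ?top v p" "nbr ?top v" "B ?top = Some p" "v \<in> dom B"
        using removed_site[OF D(1) in_B(3)] by metis
      then have "v \<noteq> ?top" using nbr_neq by blast
      then obtain j where "v = ?pt j" using domB v(4) by auto
      then have "v = w" using nbr_bump[OF s ne, of w j] nbr_sym[OF v(2)] by auto
      then have "D = ?Db" using v B_top by (simp add: bump_edge_def edge_commute[of w])
      then show False using D by simp
    qed
    ultimately have mem: "?pt l \<in> dom (map_mult D B)" "?pt r \<in> dom (map_mult D B)"
      "?top \<in> dom (map_mult D B)" by blast+
    show ?thesis
    proof (rule off_row_small[OF adj_map_mult[OF D(1) finB] s mem(1,2) _ mem(3) ne])
      show "s * ?pt r $ \<alpha> - s * ?pt l $ \<alpha> = int k - 1" using r(1) by (simp only: pt_height[OF s])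
      show "?top $ \<beta> \<noteq> ?pt l $ \<beta>" using ne by (simp add: pt_nth axis_apply)
    qed
  qed
  have "norm (\<Sum>D\<in>{Dl, Dr, ?Db}. complex_of_real (comm_sign D B) * q (map_mult D B))
      \<le> 4 * CARD('d) * (k + 2) * off_row_bound"
    by (rule approx_conserved[OF conserved[OF B] B _ _ small card])
      (use Dl Dr Db M_le_off_row_bound M_nonneg in auto)
  moreover have "map_mult ?Db B = L" by (simp add: B_def L_def map_mult_cancel)
  ultimately show ?thesis using neq sign
    by (cases "l = 0 \<or> r = 0") (auto simp: add.assoc add_diff_eq simp del: of_nat_mult of_nat_add)
qed

text \<open>This controls the term left over by the telescoping, where the bump is next to the
  deleted end. For \<open>P = PX\<close> the edge commutes with \<open>B\<close>, since the bump has
  put an X at \<open>w\<close>. For \<open>P = PY\<close> the same product arises by deleting the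
  right end of a string that carries the bump on its left end. There the left end is a Z and drops
  out, so the equation compares the product with the straight string alone.\<close>

lemma bump_boundary:
  fixes w :: "'d site"
  assumes s: "s = 1 \<or> s = -1" and ne: "\<beta> \<noteq> \<alpha>" and PR: "P \<noteq> PZ" "R \<noteq> PZ"
  defines "B \<equiv> map_mult (bump_edge \<beta> w) (line \<alpha> s w (- 1) P (int k - 2) R)"
    and "D \<equiv> edge (pt \<alpha> s w (- 1)) w P"
  shows "norm (comm_sign D B * q (map_mult D B))
    \<le> norm (q (line \<alpha> s w 0 (other P) (int k - 1) (other R))) + 4 * CARD('d) * (k + 2) * off_row_bound"
proof (cases P)
  case PX
  have "B (pt \<alpha> s w (- 1)) = Some PX" "B (pt \<alpha> s w 0) = Some PX"
    using k_ge line_pt[OF s, of \<alpha> w "-1" P "int k - 2" R 0]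
    unfolding B_def bump_line_apply(1)[OF s ne] by (auto simp: PX line_pt[OF s])
  then have "comm_sign D B = 0"
    by (simp add: D_def comm_sign_edge pt_eq_iff[OF s] PX)
  then show ?thesis using M_le_off_row_bound M_nonneg by simp
next
  case PY
  define B' where "B' = map_mult (bump_edge \<beta> w) (line \<alpha> s w 0 PX (int k - 1) (other R))"
  define Dl where "Dl = edge (pt \<alpha> s w 0) (pt \<alpha> s w (0 + 1)) PX"
  define Dr where "Dr = edge (pt \<alpha> s w (int k - 1 - 1)) (pt \<alpha> s w (int k - 1)) (other R)"
  have k: "8 \<le> int k" using k_ge by simp
  have DB: "map_mult D B = map_mult (bump_edge \<beta> w) (line \<alpha> s w 0 PX (int k - 2) R)"
    using shrink_left[OF s, of "-1" "int k - 2" P \<alpha> w R] k PR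
    by (simp add: B_def D_def map_mult_left_commute[of _ "bump_edge \<beta> w"] PY)
  have DrB': "map_mult Dr B' = map_mult D B"
    using shrink_right[OF s, of 0 "int k - 1" "other R" \<alpha> w PX] k PR
    unfolding DB by (simp add: B'_def Dr_def map_mult_left_commute[of _ "bump_edge \<beta> w"])
  have line_w: "line \<alpha> s w 0 PX (int k - 1) (other R) w = Some PX"
    using line_pt[OF s, of \<alpha> w 0 PX "int k - 1" "other R" 0] by simp
  have B'_pt: "B' (pt \<alpha> s w 0) = Some PZ" "B' (pt \<alpha> s w 1) = Some PZ"
    "B' (pt \<alpha> s w (int k - 2)) = Some PZ" "B' (pt \<alpha> s w (int k - 1)) = Some (other R)"
    unfolding B'_def bump_line_apply(1)[OF s ne] using k by (simp_all add: line_pt[OF s] line_w)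
  have "comm_sign Dl B' = 0" using B'_pt by (simp add: Dl_def comm_sign_edge pt_eq_iff[OF s])
  moreover have "comm_sign Dr B' = bond_sign (other R)"
    using B'_pt PR by (simp add: Dr_def comm_sign_edge pt_inject[OF s] Im_edge_phase_PZ)
  moreover have "norm (comm_sign Dl B' * q (map_mult Dl B') + comm_sign Dr B' * q (map_mult Dr B')
      + (if (0::int) = 0 \<or> int k - 1 = 0 then 1 else - 1) * q (line \<alpha> s w 0 PX (int k - 1) (other R)))
      \<le> 4 * CARD('d) * (k + 2) * off_row_bound"
    unfolding Dl_def Dr_def B'_def
    by (rule bump_relation[OF s ne]) (use PR k in auto)
  ultimately have "norm (bond_sign (other R) * q (map_mult D B) + q (line \<alpha> s w 0 PX (int k - 1) (other R)))
      \<le> 4 * CARD('d) * (k + 2) * off_row_bound"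
    unfolding DrB' by simp
  moreover have "norm (bond_sign (other R) * q (map_mult D B)) = norm (q (map_mult D B))"
    using PR by (cases R) auto
  ultimately have le: "norm (q (map_mult D B)) \<le> norm (q (line \<alpha> s w 0 PX (int k - 1) (other R)))
      + 4 * CARD('d) * (k + 2) * off_row_bound"
    using norm_diff_ineq[of "bond_sign (other R) * q (map_mult D B)" "q (line \<alpha> s w 0 PX (int k - 1) (other R))"]
    by linarith
  have "B (pt \<alpha> s w (- 1)) = Some PY" "B (pt \<alpha> s w 0) = Some PX"
    using k line_pt[OF s, of \<alpha> w "-1" P "int k - 2" R 0]
    unfolding B_def bump_line_apply(1)[OF s ne] by (auto simp: PY line_pt[OF s])
  then have "comm_sign D B = -1" by (simp add: D_def comm_sign_edge pt_eq_iff[OF s] PY)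
  then show ?thesis using le by (simp add: norm_mult PY)
qed (use PR in simp)

end

section \<open>Sliding a string past a fixed bump\<close>

lemma telescoping_norm_bound:
  fixes L R X :: "nat \<Rightarrow> complex"
  assumes "\<And>t. 1 \<le> t \<Longrightarrow> t \<le> n \<Longrightarrow> norm (L t + R t - X t) \<le> \<delta>"
    and "\<And>t. 1 \<le> t \<Longrightarrow> t < n \<Longrightarrow> L (Suc t) = - R t" and "1 \<le> n"
  shows "norm (L 1 + R n - (\<Sum>t=1..n. X t)) \<le> n * \<delta>"
  using assms(3,1,2)
proof (induction n rule: dec_induct)
  case base
  then show ?case using assms(1)[of 1] by simp
next
  case (step n)
  have eq: "L 1 + R (Suc n) - (\<Sum>t=1..Suc n. X t)
      = (L 1 + R n - (\<Sum>t=1..n. X t)) + (L (Suc n) + R (Suc n) - X (Suc n))"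
    using step.prems(2)[of n] step.hyps by simp
  have "norm (L 1 + R n - (\<Sum>t=1..n. X t)) \<le> n * \<delta>" using step by simp
  moreover have "norm (L (Suc n) + R (Suc n) - X (Suc n)) \<le> \<delta>" using step.prems(1) by simp
  ultimately have "norm (L 1 + R (Suc n) - (\<Sum>t=1..Suc n. X t)) \<le> n * \<delta> + \<delta>"
    unfolding eq by (intro norm_triangle_le add_mono)
  then show ?case by (simp add: algebra_simps)
qed

lemma bond_sign_funpow: "bond_sign ((other ^^ t) P) = (- 1) ^ t * bond_sign P"
proof -
  have "bond_sign (other P) = - bond_sign P" for P by (cases P) simp_all
  then show ?thesis by (induction t) simp_all
qed

lemma funpow_other_eq_PZ: "(other ^^ t) P = PZ \<longleftrightarrow> P = PZ"
  by (induction t) simp_all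

context nearly_conserved
begin

text \<open>The bump stays at \<open>w\<close> while the string slides. Each interior position
  contributes one copy of the coefficient, and each of the two boundary terms takes back at most one
  copy plus small errors.\<close>

lemma line_small:
  fixes w :: "'d site"
  assumes s: "s = 1 \<or> s = -1" and ne: "\<beta> \<noteq> \<alpha>" and PR: "P \<noteq> PZ" "R \<noteq> PZ"
  shows "(real k - 4) * norm (q (line \<alpha> s w 0 P (int k - 1) R))
    \<le> real k ^ 2 * (4 * CARD('d) * (k + 2) * M) + real k * (4 * CARD('d) * (k + 2) * off_row_bound)"
proof -
  define p where "p t = (other ^^ t) P" for t
  define r where "r t = (other ^^ t) R" for t
  define A where "A t = line \<alpha> s w (- int t) (p t) (int k - 1 - int t) (r t)" for t
  define B where "B t = map_mult (bump_edge \<beta> w) (A t)" for t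
  define Dl where "Dl t = edge (pt \<alpha> s w (- int t)) (pt \<alpha> s w (- int t + 1)) (p t)" for t
  define Dr where "Dr t = edge (pt \<alpha> s w (int k - 1 - int t - 1)) (pt \<alpha> s w (int k - 1 - int t)) (r t)" for t
  define \<rho> where "\<rho> = bond_sign P * bond_sign R"
  define X where "X t = complex_of_real (\<rho> ^ t) * q (A t)" for t
  define L where "L t = complex_of_real (\<rho> ^ t) * (comm_sign (Dl t) (B t) * q (map_mult (Dl t) (B t)))" for t
  define K where "K t = complex_of_real (\<rho> ^ t) * (comm_sign (Dr t) (B t) * q (map_mult (Dr t) (B t)))" for t
  define \<delta>1 where "\<delta>1 = 4 * CARD('d) * (k + 2) * M"
  define \<delta>2 where "\<delta>2 = 4 * CARD('d) * (k + 2) * off_row_bound"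
  \<comment> \<open>Shifts by 1 up to \<open>k - 2\<close> keep \<open>w\<close> strictly inside the
    string.\<close>
  define n where "n = k - 2"
  have n: "int n = int k - 2" "1 \<le> n" using k_ge by (auto simp: n_def)
  have p: "p t \<noteq> PZ" "p (Suc t) = other (p t)" and r: "r t \<noteq> PZ" "r (Suc t) = other (r t)" for t
    using PR by (simp_all add: p_def r_def funpow_other_eq_PZ)
  have sg: "bond_sign (p t) = (- 1) ^ t * bond_sign P" "bond_sign (r t) = (- 1) ^ t * bond_sign R" for t
    by (simp_all add: p_def r_def bond_sign_funpow)
  have sq: "bond_sign P * bond_sign P = 1" "bond_sign R * bond_sign R = 1" "\<bar>bond_sign P\<bar> = 1"
    using PR by (cases P; cases R; simp)+
  have \<rho>: "\<bar>\<rho>\<bar> = 1" using PR by (cases P; cases R) (simp_all add: \<rho>_def)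
  have norm_weight: "norm (complex_of_real (\<rho> ^ t) * z) = norm z" for t z
    by (simp add: norm_mult \<rho> norm_power)

  \<comment> \<open>By \<open>line_relation\<close> a shift multiplies the coefficient by
    \<open>\<rho>\<close>, up to a small error: the signs of both ends flip together, so their
    product is the same at every shift. As \<open>\<rho>\<close> squares to 1, \<open>X\<close> is
    almost constant.\<close>
  have step: "norm (X (Suc t) - X t) \<le> \<delta>1" for t
  proof -
    have *: "norm (bond_sign (p (Suc t)) * q (line \<alpha> s w (- int t - 1 + 1) (other (p (Suc t))) (int k - 1 - int t) (r t))
      + bond_sign (r t) * q (line \<alpha> s w (- int t - 1) (p (Suc t)) (int k - 1 - int t - 1) (other (r t)))) \<le> \<delta>1"
      unfolding \<delta>1_def by (rule line_relation[OF s p(1) r(1)]) simp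
    have le: "norm (bond_sign (p (Suc t)) * q (A t) + bond_sign (r t) * q (A (Suc t))) \<le> \<delta>1"
    proof -
      have "- int (Suc t) + 1 = - int t" "- int t - 1 = - int (Suc t)" "int k - 1 - int t - 1 = int k - 1 - int (Suc t)" by simp_all
      then show ?thesis using * by (simp only: A_def p(2) r(2) other_other diff_add_cancel)
    qed
    define c where "c = \<rho> ^ t * (- 1) ^ t * bond_sign P"
    have "\<bar>c\<bar> = 1" by (simp add: c_def abs_mult power_abs \<rho> sq)
    moreover have "c * bond_sign (p (Suc t)) = - (\<rho> ^ t)" "c * bond_sign (r t) = \<rho> ^ Suc t"
      using sq by (simp_all add: c_def sg \<rho>_def algebra_simps flip: power_mult_distrib)
    then have "X (Suc t) - X t = of_real c * (bond_sign (p (Suc t)) * q (A t) + bond_sign (r t) * q (A (Suc t)))"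
      by (simp only: X_def distrib_left mult.assoc[symmetric] of_real_mult[symmetric]) simp
    ultimately show ?thesis using le by (simp add: norm_mult)
  qed
  have X_near: "norm (X t - X 0) \<le> t * \<delta>1" for t
  proof (induction t)
    case (Suc t)
    have "norm (X (Suc t) - X 0) \<le> norm (X (Suc t) - X t) + norm (X t - X 0)"
      using norm_triangle_ineq[of "X (Suc t) - X t" "X t - X 0"] by simp
    then show ?case using Suc step[of t] by (simp add: algebra_simps)
  qed simp

  have bump: "norm (L t + K t - X t) \<le> \<delta>2" if t: "1 \<le> t" "t \<le> n" for t
  proof -
    have "norm (comm_sign (Dl t) (B t) * q (map_mult (Dl t) (B t)) + comm_sign (Dr t) (B t) * q (map_mult (Dr t) (B t))
      + (if - int t = 0 \<or> int k - 1 - int t = 0 then 1 else - 1) * q (A t)) \<le> \<delta>2"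
      unfolding \<delta>2_def Dl_def Dr_def B_def A_def
      by (rule bump_relation[OF s ne p(1) r(1)]) (use t n in auto)
    then have "norm (complex_of_real (\<rho> ^ t) * (comm_sign (Dl t) (B t) * q (map_mult (Dl t) (B t))
      + comm_sign (Dr t) (B t) * q (map_mult (Dr t) (B t)) - q (A t))) \<le> \<delta>2"
      unfolding norm_weight using t n by simp
    then show ?thesis by (simp only: L_def K_def X_def right_diff_distrib distrib_left)
  qed
  \<comment> \<open>Deleting the left end after \<open>t + 1\<close> shifts, or the right end after
    \<open>t\<close> shifts, leaves the bumped string on the positions \<open>- t\<close> to
    \<open>k - 2 - t\<close>. The bounds on \<open>t\<close> keep both deleted edges away from
    \<open>w\<close>, so the bump does not affect their signs.\<close>
  have link: "L (Suc t) = - K t" if t: "1 \<le> t" "t < n" for t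
  proof -
    have "map_mult (Dl (Suc t)) (A (Suc t)) = line \<alpha> s w (- int (Suc t) + 1) (other (p (Suc t))) (int k - 1 - int (Suc t)) (r (Suc t))"
      unfolding Dl_def A_def by (rule shrink_left[OF s _ p(1)]) (use k_ge in simp)
    moreover have "map_mult (Dr t) (A t) = line \<alpha> s w (- int t) (p t) (int k - 1 - int t - 1) (other (r t))"
      unfolding Dr_def A_def by (rule shrink_right[OF s _ r(1)]) (use k_ge in simp)
    ultimately have "map_mult (Dl (Suc t)) (A (Suc t)) = map_mult (Dr t) (A t)"
      by (simp add: p r algebra_simps)
    then have eq: "map_mult (Dl (Suc t)) (B (Suc t)) = map_mult (Dr t) (B t)"
      by (simp add: B_def map_mult_left_commute[of _ "bump_edge \<beta> w"])
    have "comm_sign (Dl (Suc t)) (B (Suc t)) = bond_sign (p (Suc t))"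
    proof -
      have "B (Suc t) (pt \<alpha> s w (- int (Suc t))) = Some (p (Suc t))"
        "B (Suc t) (pt \<alpha> s w (- int (Suc t) + 1)) = Some PZ"
        unfolding B_def A_def bump_line_apply(1)[OF s ne] using t n by (simp_all add: line_pt[OF s])
      then show ?thesis by (simp add: Dl_def comm_sign_edge pt_inject[OF s] Im_edge_phase_PZ p)
    qed
    moreover have "comm_sign (Dr t) (B t) = bond_sign (r t)"
    proof -
      have "B t (pt \<alpha> s w (int k - 1 - int t)) = Some (r t)"
        "B t (pt \<alpha> s w (int k - 1 - int t - 1)) = Some PZ"
        unfolding B_def A_def bump_line_apply(1)[OF s ne] using t n by (simp_all add: line_pt[OF s])
      then show ?thesis by (simp add: Dr_def comm_sign_edge pt_inject[OF s] Im_edge_phase_PZ r)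
    qed
    moreover have "\<rho> ^ Suc t * bond_sign (p (Suc t)) = - (\<rho> ^ t * bond_sign (r t))"
      using sq by (simp add: sg \<rho>_def algebra_simps)
    ultimately show ?thesis unfolding L_def K_def eq
      by (simp only: mult.assoc[symmetric] of_real_mult[symmetric]) simp
  qed
  \<comment> \<open>The weights \<open>\<rho> ^ t\<close> make the bumped strings cancel in pairs while the \<open>n\<close> contributions of
    the straight string all have the same sign.\<close>
  have "norm (L 1 + K n - (\<Sum>t=1..n. X t)) \<le> n * \<delta>2"
    by (rule telescoping_norm_bound) (use bump link n(2) in auto)
  moreover have "norm (L 1) \<le> norm (X 0) + \<delta>2"
  proof -
    have "norm (comm_sign (Dl 1) (B 1) * q (map_mult (Dl 1) (B 1)))
        \<le> norm (q (line \<alpha> s w 0 (other (p 1)) (int k - 1) (other (r 1)))) + \<delta>2"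
      using bump_boundary[OF s ne p(1)[of 1] r(1)[of 1], of w] by (simp add: Dl_def B_def A_def \<delta>2_def)
    then show ?thesis using p(2)[of 0] r(2)[of 0]
      unfolding L_def norm_weight by (simp add: X_def A_def p_def r_def)
  qed
  \<comment> \<open>Mirror image of the left boundary: in orientation \<open>- s\<close> the string
    shifted \<open>n\<close> times starts at position -1. The comparison string is now the one after
    \<open>k - 1\<close> shifts, which costs the drift estimated next.\<close>
  moreover have "norm (K n) \<le> norm (X (k - 1)) + \<delta>2"
  proof -
    have s': "- s = 1 \<or> - s = -1" using s by auto
    have "A n = line \<alpha> (- s) w (- 1) (r n) (int k - 2) (p n)"
    proof -
      have "- int n = - (int k - 2)" "int k - 1 - int n = - (- 1)" using n by simp_all
      then show ?thesis unfolding A_def using k_ge by (simp only: line_reflect[of "- 1" "int k - 2"])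
    qed
    moreover have "Dr n = edge (pt \<alpha> (- s) w (- 1)) w (r n)"
      using n by (simp add: Dr_def pt_reflect edge_commute[of w])
    ultimately have "norm (comm_sign (Dr n) (B n) * q (map_mult (Dr n) (B n)))
        \<le> norm (q (line \<alpha> (- s) w 0 (other (r n)) (int k - 1) (other (p n)))) + \<delta>2"
      using bump_boundary[OF s' ne r(1)[of n] p(1)[of n], of w] by (simp add: B_def \<delta>2_def)
    moreover have "line \<alpha> (- s) w 0 (other (r n)) (int k - 1) (other (p n)) = A (k - 1)"
    proof -
      have "k - 1 = Suc n" using k_ge by (simp add: n_def)
      then show ?thesis
        using line_reflect[of 0 "int k - 1" \<alpha> s w "other (r n)" "other (p n)"] n by (simp add: A_def p r)
    qed
    ultimately show ?thesis unfolding K_def X_def norm_weight by simp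
  qed
  moreover have "norm (X (k - 1)) \<le> norm (X 0) + k * \<delta>1"
  proof -
    have \<delta>1: "0 \<le> \<delta>1" using M_nonneg by (simp add: \<delta>1_def)
    have "norm (X (k - 1)) \<le> norm (X (k - 1) - X 0) + norm (X 0)"
      using norm_triangle_ineq[of "X (k - 1) - X 0" "X 0"] by simp
    moreover have "real (k - 1) * \<delta>1 \<le> k * \<delta>1" using \<delta>1 by (intro mult_right_mono) auto
    ultimately show ?thesis using X_near[of "k - 1"] by linarith
  qed
  moreover have "n * norm (X 0) \<le> norm (\<Sum>t=1..n. X t) + n * (n * \<delta>1)"
  proof -
    have \<delta>1: "0 \<le> \<delta>1" using M_nonneg by (simp add: \<delta>1_def)
    have "norm ((\<Sum>t=1..n. X t) - n * X 0) = norm (\<Sum>t=1..n. X t - X 0)"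
      by (simp add: sum_subtractf)
    also have "\<dots> \<le> (\<Sum>t=1..n. n * \<delta>1)"
    proof (rule sum_norm_le)
      fix t assume "t \<in> {1..n}"
      then have "t * \<delta>1 \<le> n * \<delta>1" using \<delta>1 by (intro mult_right_mono) auto
      then show "norm (X t - X 0) \<le> n * \<delta>1" using X_near[of t] by linarith
    qed
    also have "\<dots> = n * (n * \<delta>1)" by simp
    finally have "norm (n * X 0) \<le> norm (\<Sum>t=1..n. X t) + n * (n * \<delta>1)"
      using norm_triangle_ineq3[of "\<Sum>t=1..n. X t" "n * X 0"] by linarith
    then show ?thesis by (simp add: norm_mult)
  qed
  moreover have "norm (\<Sum>t=1..n. X t) \<le> norm (L 1) + norm (K n) + norm (L 1 + K n - (\<Sum>t=1..n. X t))"
    using norm_triangle_ineq[of "L 1" "K n"] norm_triangle_ineq3[of "L 1 + K n" "\<Sum>t=1..n. X t"] by linarith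
  ultimately have "n * norm (X 0) \<le> n * \<delta>2 + 2 * \<delta>2 + 2 * norm (X 0) + k * \<delta>1 + n * (n * \<delta>1)"
    by linarith
  moreover have "real n = real k - 2" using n k_ge by (simp add: n_def of_nat_diff)
  ultimately have "(real k - 4) * norm (X 0) \<le> real k * \<delta>2 + (k + (real k - 2) ^ 2) * \<delta>1"
    by (simp add: algebra_simps power2_eq_square)
  moreover have "(k + (real k - 2) ^ 2) * \<delta>1 \<le> real k ^ 2 * \<delta>1"
    by (rule mult_right_mono) (use k_ge M_nonneg in \<open>auto simp: power2_eq_square algebra_simps \<delta>1_def\<close>)
  moreover have "X 0 = q (line \<alpha> s w 0 P (int k - 1) R)" by (simp add: X_def A_def p_def r_def)
  ultimately show ?thesis by (simp add: \<delta>1_def \<delta>2_def)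
qed

text \<open>Two equations are nested: the bumped string multiplies \<open>off_row_bound\<close> by
  another factor \<open>4 * CARD('d) * (k + 2)\<close>, whence the square of the dimension. With the
  number of positions this gives degree \<open>CARD('d) + 3\<close> before the division by
  \<open>k - 4\<close>.\<close>

lemma narrow_bound:
  assumes A: "A \<in> pauli_products" and wu: "w \<in> dom A" "u \<in> dom A" "u $ \<alpha> - w $ \<alpha> = int k - 1"
    and d: "CARD('d) \<ge> 2" and k: "22 \<le> k"
  shows "norm (q A) \<le> 4 * real CARD('d) ^ 2 * real (k + 1) ^ (CARD('d) + 3) * M"
proof -
  define c where "c = real CARD('d)"
  define K where "K = real k"
  define Y where "Y = K ^ CARD('d)"
  have c: "1 \<le> c" and K: "22 \<le> K" using d k by (simp_all add: c_def K_def)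
  have Y: "1 \<le> Y" unfolding Y_def using K by (intro one_le_power) simp
  have nn: "0 \<le> c" "0 \<le> K" "0 \<le> Y" "0 \<le> M" using c K Y M_nonneg by auto
  have eps: "off_row_bound = K * (4 * c * (Y + 1) * M)"
    by (simp add: off_row_bound_def c_def K_def Y_def distrib_left)
  have eps_le: "off_row_bound \<le> 8 * c * (K * Y * M)"
  proof -
    have "(Y + 1) * (4 * c * K * M) \<le> (2 * Y) * (4 * c * K * M)"
      by (rule mult_right_mono) (use Y nn in auto)
    then show ?thesis by (simp add: eps mult_ac)
  qed
  have cc: "c \<le> c ^ 2" using self_le_power[OF c, of 2] by simp
  have "norm (q A) \<le> 4 * c ^ 2 * (K ^ 3 * Y) * M"
  proof (cases "norm (q A) \<le> off_row_bound")
    case True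
    also note eps_le
    also have "8 * c * (K * Y * M) \<le> (4 * c ^ 2 * K ^ 2) * (K * Y * M)"
    proof (rule mult_right_mono)
      have "c * 2 \<le> c ^ 2 * K ^ 2"
        by (rule mult_mono[OF cc]) (use power_mono[of 22 K 2] K in auto)
      then show "8 * c \<le> 4 * c ^ 2 * K ^ 2" by (simp add: mult_ac)
    qed (use nn in auto)
    finally show ?thesis by (simp add: power3_eq_cube power2_eq_square mult_ac)
  next
    case False
    then obtain P R where PR: "P \<noteq> PZ" "R \<noteq> PZ" and A_eq: "A = line \<alpha> 1 w 0 P (int k - 1) R"
      using line_or_small[OF A _ wu(1,2), of 1 \<alpha>] wu(3) by auto
    have "\<exists>\<beta>. \<beta> \<noteq> \<alpha>"
    proof (rule ccontr)
      assume "\<not> ?thesis"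
      then have "(UNIV :: 'd set) = {\<alpha>}" by auto
      then have "CARD('d) = 1" by (metis card_1_singleton_iff One_nat_def)
      then show False using d by simp
    qed
    then obtain \<beta> where ne: "\<beta> \<noteq> \<alpha>" by blast
    have "(K - 4) * norm (q A) \<le> K ^ 2 * (4 * c * (K + 2) * M) + K * (4 * c * (K + 2) * off_row_bound)"
      using line_small[OF _ ne PR, of 1 w] by (simp add: A_eq K_def c_def algebra_simps)
    also have "\<dots> \<le> 8 * c ^ 2 * (K ^ 3 * Y) * M + 64 * c ^ 2 * (K ^ 3 * Y) * M"
    proof (rule add_mono)
      have "K ^ 2 * (4 * c * (K + 2) * M) = (c * (K + 2)) * (4 * K ^ 2 * M)" by simp
      also have "\<dots> \<le> (c ^ 2 * (2 * K * Y)) * (4 * K ^ 2 * M)"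
      proof (intro mult_right_mono mult_mono cc)
        have "K + 2 \<le> 2 * K * 1" using K by simp
        also have "\<dots> \<le> 2 * K * Y" by (rule mult_left_mono) (use Y nn in auto)
        finally show "K + 2 \<le> 2 * K * Y" .
      qed (use nn in auto)
      finally show "K ^ 2 * (4 * c * (K + 2) * M) \<le> 8 * c ^ 2 * (K ^ 3 * Y) * M"
        by (simp add: power3_eq_cube power2_eq_square mult_ac)
      have "K * (4 * c * (K + 2) * off_row_bound) \<le> K * (4 * c * (2 * K) * (8 * c * (K * Y * M)))"
      proof (intro mult_left_mono mult_mono eps_le)
        show "0 \<le> off_row_bound" using M_le_off_row_bound M_nonneg by simp
      qed (use K nn in auto)
      then show "K * (4 * c * (K + 2) * off_row_bound) \<le> 64 * c ^ 2 * (K ^ 3 * Y) * M"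
        by (simp add: power3_eq_cube power2_eq_square mult_ac)
    qed
    also have "\<dots> = 18 * (4 * c ^ 2 * (K ^ 3 * Y) * M)" by simp
    \<comment> \<open>The number 22 comes from here: 8 + 64 is 18 times 4, and \<open>K - 4\<close>
      must be at least 18. The gain from the telescoping serves to absorb this constant.\<close>
    also have "\<dots> \<le> (K - 4) * (4 * c ^ 2 * (K ^ 3 * Y) * M)"
      by (rule mult_right_mono) (use K nn in auto)
    finally show ?thesis using K by simp
  qed
  also have "\<dots> \<le> 4 * c ^ 2 * (K + 1) ^ (CARD('d) + 3) * M"
  proof (intro mult_right_mono mult_left_mono)
    have "K ^ 3 * Y = K ^ (CARD('d) + 3)" by (simp add: Y_def power_add)
    also have "\<dots> \<le> (K + 1) ^ (CARD('d) + 3)" by (rule power_mono) (use nn in auto)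
    finally show "K ^ 3 * Y \<le> (K + 1) ^ (CARD('d) + 3)" .
  qed (use nn in auto)
  finally show ?thesis by (simp add: c_def K_def add.commute)
qed

end

subsection \<open>Iteration over the width\<close>

lemma wid_dir_le_iff:
  fixes S :: "('d::finite) site set"
  assumes S: "finite S" "S \<noteq> {}"
  shows "wid_dir \<alpha> S \<le> m \<longleftrightarrow> (\<forall>u\<in>S. \<forall>v\<in>S. v $ \<alpha> - u $ \<alpha> < int m)"
proof -
  define Q where "Q k \<longleftrightarrow> (\<exists>a::int. \<forall>u\<in>S. 0 \<le> u $ \<alpha> - a \<and> u $ \<alpha> - a \<le> int k - 1)" for k
  have Q_iff: "Q k \<longleftrightarrow> (\<forall>u\<in>S. \<forall>v\<in>S. v $ \<alpha> - u $ \<alpha> < int k)" for k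
  proof
    assume "Q k"
    then obtain a :: int where a: "\<forall>u\<in>S. 0 \<le> u $ \<alpha> - a \<and> u $ \<alpha> - a \<le> int k - 1" unfolding Q_def by blast
    show "\<forall>u\<in>S. \<forall>v\<in>S. v $ \<alpha> - u $ \<alpha> < int k"
    proof (intro ballI)
      fix u v assume "u \<in> S" "v \<in> S"
      then have "0 \<le> u $ \<alpha> - a" "v $ \<alpha> - a \<le> int k - 1" using a by auto
      then show "v $ \<alpha> - u $ \<alpha> < int k" by linarith
    qed
  next
    assume *: "\<forall>u\<in>S. \<forall>v\<in>S. v $ \<alpha> - u $ \<alpha> < int k"
    define a where "a = Min ((\<lambda>x. x $ \<alpha>) ` S)"
    have "a \<in> (\<lambda>x. x $ \<alpha>) ` S" unfolding a_def using S by (intro Min_in) auto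
    then obtain y where y: "y \<in> S" "a = y $ \<alpha>" by auto
    have "0 \<le> u $ \<alpha> - a \<and> u $ \<alpha> - a \<le> int k - 1" if "u \<in> S" for u
    proof -
      have "a \<le> u $ \<alpha>" unfolding a_def using S that by (intro Min_le) auto
      moreover have "u $ \<alpha> - y $ \<alpha> < int k" using * that y(1) by blast
      ultimately show ?thesis using y(2) by linarith
    qed
    then show "Q k" unfolding Q_def by blast
  qed
  define f where "f = (\<lambda>(u, v). (v::'d site) $ \<alpha> - u $ \<alpha>)"
  have "Q (Suc (nat (Max (f ` (S \<times> S)))))"
    unfolding Q_iff
  proof (intro ballI)
    fix u v assume "u \<in> S" "v \<in> S"
    then have "f (u, v) \<le> Max (f ` (S \<times> S))" using S by (intro Max_ge) auto
    then show "v $ \<alpha> - u $ \<alpha> < int (Suc (nat (Max (f ` (S \<times> S)))))" by (simp add: f_def)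
  qed
  then have "Q (wid_dir \<alpha> S)" unfolding wid_dir_def Q_def by (rule LeastI)
  moreover have "wid_dir \<alpha> S \<le> m" if "Q m"
    using that unfolding wid_dir_def Q_def by (rule Least_le)
  ultimately show ?thesis
    unfolding Q_iff by (metis int_ops(1) of_nat_mono order_less_le_trans)
qed

text \<open>Width counts layers, one more than the largest coordinate difference. Used with
  \<open>m = k\<close> this supplies \<open>wide_pos\<close>, and with \<open>m = k - 1\<close> the
  pair of sites for \<open>narrow_bound\<close>.\<close>

lemma less_wid_iff:
  fixes A :: "('d::finite) pauli_map"
  assumes "A \<in> pauli_products"
  shows "m < wid A \<longleftrightarrow> (\<exists>\<alpha>. \<exists>u\<in>dom A. \<exists>v\<in>dom A. int m \<le> v $ \<alpha> - u $ \<alpha>)"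
proof -
  have S: "finite (dom A)" "dom A \<noteq> {}" using assms by (auto simp: pauli_products_def)
  have "m < wid A \<longleftrightarrow> (\<exists>\<alpha>. m < wid_dir \<alpha> (dom A))"
    unfolding wid_def by (subst Max_gr_iff) auto
  also have "\<dots> \<longleftrightarrow> (\<exists>\<alpha>. \<not> (\<forall>u\<in>dom A. \<forall>v\<in>dom A. v $ \<alpha> - u $ \<alpha> < int m))"
    by (simp only: wid_dir_le_iff[OF S, symmetric] not_le)
  finally show ?thesis by (meson not_less)
qed

theorem propositionA2:
  fixes F :: "nat \<Rightarrow> real"
  assumes "CARD('d::finite) \<ge> 2"
    and "\<And>k. F k > 0"
    and "antimono F"
    and "(\<lambda>k. (4 * real CARD('d) ^ 2) ^ k * fact k ^ (CARD('d) + 3) * F k) \<longlonglongrightarrow> 0"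
  shows "\<not> (\<exists>q :: 'd candidate. quasi_local_conserved_quantity F q)"
proof
  assume "\<exists>q :: 'd candidate. quasi_local_conserved_quantity F q"
  then obtain q :: "'d candidate" where
    decay: "\<And>A. A \<in> pauli_products \<Longrightarrow> norm (q A) \<le> F (wid A)"
    and cons: "\<And>B. B \<in> pauli_products \<Longrightarrow> conserved_coeff q B = 0"
    and nonlocal: "\<not> local_conserved_quantity q"
    unfolding quasi_local_conserved_quantity_def by blast
  define G where "G j = 4 * real CARD('d) ^ 2 * real (j + 1) ^ (CARD('d) + 3)" for j
  have four: "1 \<le> 4 * real CARD('d) ^ 2"
  proof -
    have "1 \<le> real CARD('d) ^ 2" using assms(1) by (intro one_le_power) simp
    then show ?thesis by linarith
  qed
  have G: "1 \<le> G j" for j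
  proof -
    have "1 * 1 \<le> G j" unfolding G_def by (rule mult_mono[OF four one_le_power]) auto
    then show ?thesis by simp
  qed
  \<comment> \<open>Induction on \<open>n\<close> for all \<open>k\<close> at once: the hypothesis
    at \<open>k + 1\<close> bounds every product wider than \<open>k\<close>, which is the
    \<open>M\<close> of the locale. Decay is used only at the far end \<open>k + n\<close>, which is
    later sent to infinity.\<close>
  have bound: "norm (q A) \<le> (\<Prod>j=k..<k + n. G j) * F (k + n)"
    if "22 \<le> k" "A \<in> pauli_products" "k \<le> wid A" for k n A
    using that
  proof (induction n arbitrary: k A)
    case 0
    then show ?case using decay[of A] antimonoD[OF assms(3), of k "wid A"] by simp
  next
    case (Suc n)
    define M where "M = (\<Prod>j=Suc k..<Suc k + n. G j) * F (Suc k + n)"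
    have M: "0 \<le> M" unfolding M_def
      using assms(2)[of "Suc k + n"] order_trans[OF zero_le_one G] by (intro mult_nonneg_nonneg prod_nonneg) auto
    have IH: "norm (q A) \<le> M" if "A \<in> pauli_products" "k < wid A" for A
      unfolding M_def by (rule Suc.IH) (use Suc.prems(1) that in auto)
    interpret nearly_conserved q k M
    proof
      show "norm (q A) \<le> M" if "A \<in> pauli_products" "u \<in> dom A" "v \<in> dom A" "int k \<le> v $ \<gamma> - u $ \<gamma>" for A u v \<gamma>
        using IH[OF that(1)] less_wid_iff[OF that(1)] that by blast
    qed (use cons M Suc.prems in auto)
    have "norm (q A) \<le> G k * M"
    proof (cases "k < wid A")
      case True
      have "1 * M \<le> G k * M" by (rule mult_right_mono[OF G M])
      then show ?thesis using IH[OF Suc.prems(2) True] by simp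
    next
      case False
      have "k - 1 < wid A" using Suc.prems by simp
      then obtain \<alpha> u v where uv: "u \<in> dom A" "v \<in> dom A" "int (k - 1) \<le> v $ \<alpha> - u $ \<alpha>"
        using less_wid_iff[OF Suc.prems(2)] by blast
      moreover have "\<not> int k \<le> v $ \<alpha> - u $ \<alpha>"
        using False less_wid_iff[OF Suc.prems(2), of k] uv by blast
      ultimately have "v $ \<alpha> - u $ \<alpha> = int k - 1" using Suc.prems(1) by simp
      then show ?thesis unfolding G_def
        by (rule narrow_bound[OF Suc.prems(2) uv(1,2) _ assms(1) Suc.prems(1)])
    qed
    also have "\<dots> = (\<Prod>j=k..<k + Suc n. G j) * F (k + Suc n)"
      by (simp add: M_def prod.atLeast_Suc_lessThan mult.assoc)
    finally show ?case .
  qed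
  \<comment> \<open>The \<open>j + 1\<close> in \<open>G\<close> makes the product a piece of a
    factorial power. The missing factors below \<open>k\<close> are at least 1 and are filled in to
    match the hypothesis on \<open>F\<close>.\<close>
  have prod_le: "(\<Prod>j=k..<k + n. G j) \<le> (4 * real CARD('d) ^ 2) ^ (k + n) * fact (k + n) ^ (CARD('d) + 3)" for k n
  proof (induction n)
    case 0
    have "1 * 1 \<le> (4 * real CARD('d) ^ 2) ^ k * fact k ^ (CARD('d) + 3)"
      by (rule mult_mono[OF one_le_power[OF four] one_le_power]) (use four in auto)
    then show ?case by simp
  next
    case (Suc n)
    have "(\<Prod>j=k..<k + Suc n. G j) = (\<Prod>j=k..<k + n. G j) * G (k + n)" by simp
    also have "\<dots> \<le> (4 * real CARD('d) ^ 2) ^ (k + n) * fact (k + n) ^ (CARD('d) + 3) * G (k + n)"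
      using order_trans[OF zero_le_one G] by (intro mult_right_mono Suc)
    also have "\<dots> = (4 * real CARD('d) ^ 2) ^ (k + Suc n) * fact (k + Suc n) ^ (CARD('d) + 3)"
    proof -
      have "fact (k + Suc n) = (fact (k + n) :: real) * real (k + n + 1)" by (simp add: algebra_simps)
      then show ?thesis by (simp only: G_def power_mult_distrib add_Suc_right power_Suc mult_ac)
    qed
    finally show ?case .
  qed
  have "q A = 0" if A: "A \<in> pauli_products" "22 < wid A" for A
  proof -
    let ?c = "\<lambda>k. (4 * real CARD('d) ^ 2) ^ k * fact k ^ (CARD('d) + 3) * F k"
    have "norm (q A) \<le> ?c (n + 22)" for n
    proof -
      have "norm (q A) \<le> (\<Prod>j=22..<22 + n. G j) * F (22 + n)" by (rule bound) (use A in auto)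
      also have "\<dots> \<le> ?c (22 + n)"
        by (rule mult_right_mono[OF prod_le]) (use assms(2)[of "22 + n"] in simp)
      finally show ?thesis by (simp add: add.commute)
    qed
    then have "norm (q A) \<le> 0"
      using LIMSEQ_le_const[OF LIMSEQ_ignore_initial_segment[OF assms(4), of 22]] by blast
    then show ?thesis by simp
  qed
  then have "local_conserved_quantity q"
    unfolding local_conserved_quantity_def using cons by blast
  then show False using nonlocal by blast
qed

end
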